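(* Let $c_1,c_2,c_3\in\mathbb{C}$ with $c_1\neq0$ or $c_2\neq0$, and let $L=c_1\partial_t+c_2\partial_x+c_3$ on $\mathbb{T}^1\times\mathbb{R}$. Then for every $f\in\mathcal{S}(\mathbb{T}^1\times\mathbb{R})$ such that $\widetilde{f}(k,\xi)=0$ for all $(k,\xi)\in\mathbb{Z}\times\mathbb{R}$ with $p(k,\xi)=0$, where $p(k,\xi)=ic_1k+ic_2\xi+c_3$, there exists $u\in\mathcal{S}(\mathbb{T}^1\times\mathbb{R})$ with $Lu=f$; that is, $L$ is globally solvable.
   Context: $\mathbb{T}^1=\mathbb{R}/2\pi\mathbb{Z}$. $\mathcal{S}(\mathbb{T}^1\times\mathbb{R})$ is the space of $f\in C^\infty(\mathbb{T}^1\times\mathbb{R})$ with $\sup_{t,x}|x^\gamma\partial_t^\alpha\partial_x^\beta f(t,x)|<\infty$ for all $\alpha,\beta,\gamma\in\mathbb{N}_0$. The mixed partial Fourier transform of $f$ is $\widetilde{f}(k,\xi)=\frac{1}{2\pi}\int_0^{2\pi}\int_{\mathbb{R}}f(t,x)e^{-i(kt+x\xi)}\,dx\,dt$ for $k\in\mathbb{Z}$, $\xi\in\mathbb{R}$; with this transform $\widetilde{Lv}(k,\xi)=p(k,\xi)\widetilde{v}(k,\xi)$. For a constant coefficient operator with symbol $p$ in this sense, "globally solvable" means: for every $f\in\mathcal{S}(\mathbb{T}^1\times\mathbb{R})$ with $\widetilde f=0$ on the zero set of $p$ there is $u\in\mathcal{S}(\mathbb{T}^1\times\mathbb{R})$ with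 $Lu=f$. *)

theory Defs
  imports "HOL-Analysis.Analysis"
begin

text \<open>Functions on T^1 x R are modelled as functions on R x R (first argument t, second x)
  which are 2 pi-periodic in t.\<close>

definition dt :: "(real \<times> real \<Rightarrow> complex) \<Rightarrow> (real \<times> real \<Rightarrow> complex)" where
  "dt f = (\<lambda>(t, x). vector_derivative (\<lambda>s. f (s, x)) (at t))"

definition dx :: "(real \<times> real \<Rightarrow> complex) \<Rightarrow> (real \<times> real \<Rightarrow> complex)" where
  "dx f = (\<lambda>(t, x). vector_derivative (\<lambda>y. f (t, y)) (at x))"

fun pd :: "bool list \<Rightarrow> (real \<times> real \<Rightarrow> complex) \<Rightarrow> (real \<times> real \<Rightarrow> complex)" where
  "pd [] f = f"
| "pd (True # w) f = dt (pd w f)"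
| "pd (False # w) f = dx (pd w f)"

definition smooth2 :: "(real \<times> real \<Rightarrow> complex) \<Rightarrow> bool" where
  "smooth2 f \<longleftrightarrow> (\<forall>w. continuous_on UNIV (pd w f)
      \<and> (\<forall>t x. (\<lambda>s. pd w f (s, x)) differentiable (at t))
      \<and> (\<forall>t x. (\<lambda>y. pd w f (t, y)) differentiable (at x)))"

definition periodic_t :: "(real \<times> real \<Rightarrow> complex) \<Rightarrow> bool" where
  "periodic_t f \<longleftrightarrow> (\<forall>t x. f (t + 2 * pi, x) = f (t, x))"

definition schwartz_TR :: "(real \<times> real \<Rightarrow> complex) set" where
  "schwartz_TR = {f. smooth2 f \<and> periodic_t f \<and>
     (\<forall>\<alpha> \<beta> \<gamma> :: nat. \<exists>C. \<forall>t x.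
        norm (of_real (x ^ \<gamma>) * pd (replicate \<alpha> True @ replicate \<beta> False) f (t, x)) \<le> C)}"

definition mixed_ft :: "(real \<times> real \<Rightarrow> complex) \<Rightarrow> int \<Rightarrow> real \<Rightarrow> complex" where
  "mixed_ft f k \<xi> = (1 / (2 * of_real pi)) *
     (\<integral>t \<in> {0..2*pi}. (\<integral>x. f (t, x) * exp (- \<i> * of_real (of_int k * t + x * \<xi>)) \<partial>lborel) \<partial>lborel)"

definition symb :: "complex \<Rightarrow> complex \<Rightarrow> complex \<Rightarrow> int \<Rightarrow> real \<Rightarrow> complex" where
  "symb c1 c2 c3 k \<xi> = \<i> * c1 * of_int k + \<i> * c2 * of_real \<xi> + c3"

definition Lop :: "complex \<Rightarrow> complex \<Rightarrow> complex \<Rightarrow> (real \<times> real \<Rightarrow> complex) \<Rightarrow> (real \<times> real \<Rightarrow> complex)" where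
  "Lop c1 c2 c3 u = (\<lambda>p. c1 * dt u p + c2 * dx u p + c3 * u p)"

end

(* Expand in a Fourier series in t alone.  With f_k(x) the k-th coefficient and
   m_k = i c1 k + c3, a solution u = sum_k e^(ikt) v_k(x) must satisfy c2 v_k' + m_k v_k = f_k.
   If c2 = 0, divide by m_k; the numbers m_k that are nonzero stay away from 0, and where m_k = 0
   the hypothesis and injectivity of the Fourier transform on R force f_k = 0.
   If c2 is nonzero, put l_k = m_k / c2 and integrate e^(-l_k (x - y)) f_k(y) / c2 from minus
   infinity (from plus infinity if Re l_k < 0).  The nonzero numbers Re l_k stay away from 0, which
   makes all estimates uniform in k; if Re l_k = 0, the symbol vanishes at xi = -Im l_k and the
   hypothesis says exactly that the integral over the whole line vanishes, so that the solution
   decays at both ends.  The rapid decay of f_k in k and x thus passes to v_k, and u is Schwartz. *)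
theory Submission
  imports Defs "HOL-Library.Nat_Bijection" "HOL-Probability.Levy" "HOL-Probability.Sinc_Integral"
begin

section \<open>Fourier series with rapidly decreasing coefficients\<close>

text \<open>Expanding in \<open>t\<close> alone avoids dividing the full transform by the symbol,
  where smoothness and decay of the quotient would have to be checked at every zero. On the
  \<open>x\<close> side such a zero becomes one vanishing integral. No small denominators arise,
  because only one integer frequency is involved: \<open>k \<mapsto> a k + b\<close> is either
  constant or of modulus below 1 for finitely many \<open>k\<close> only. What has to be watched is
  uniformity in \<open>k\<close>. The constants in the estimate for the differential equation
  therefore depend on \<open>l_k\<close> only through the gap \<open>\<delta>\<close>. Since
  \<open>m_k\<close> grows at most linearly, the equation itself then turns decay of
  \<open>v_k\<close> into decay of all its derivatives, each costing one power of
  \<open>1 + |k|\<close>. Two uniqueness facts carry the rest: completeness of the exponentials on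
  the circle comes from Stone--Weierstrass, and injectivity of the Fourier transform on the line
  from Levy's theorem that a characteristic function determines its distribution.\<close>

text \<open>\<open>v k b\<close> plays the role of the \<open>b\<close>-th derivative of the \<open>k\<close>-th Fourier
  coefficient in \<open>t\<close>; carrying all derivatives makes both partial derivatives of the Fourier
  series again series of such families.\<close>

definition rapid :: "(int \<Rightarrow> nat \<Rightarrow> real \<Rightarrow> complex) \<Rightarrow> bool" where
  "rapid v \<longleftrightarrow> (\<forall>k b x. (v k b has_vector_derivative v k (Suc b) x) (at x)) \<and>
     (\<forall>a b c. \<exists>C. \<forall>k x. (1 + \<bar>of_int k\<bar>) ^ a * (1 + \<bar>x\<bar>) ^ c * norm (v k b x) \<le> C)"

definition emode :: "int \<Rightarrow> real \<Rightarrow> complex" where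
  "emode k t = exp (\<i> * of_real (of_int k * t))"

text \<open>The integers are enumerated by \<open>int_decode\<close> so that \<open>suminf\<close>
  applies; for rapid families the series converges absolutely, so the order is immaterial. Only the
  entries with \<open>b = 0\<close> are evaluated; the others hold the derivatives in
  readiness.\<close>

definition fser :: "(int \<Rightarrow> nat \<Rightarrow> real \<Rightarrow> complex) \<Rightarrow> real \<times> real \<Rightarrow> complex" where
  "fser v = (\<lambda>(t, x). \<Sum>n. emode (int_decode n) t * v (int_decode n) 0 x)"

lemma norm_emode [simp]: "norm (emode k t) = 1"
  by (simp add: emode_def)

lemma emode_add: "emode (j + k) t = emode j t * emode k t"
  by (simp add: emode_def exp_add [symmetric] algebra_simps)

lemma emode_0 [simp]: "emode 0 t = 1"
  by (simp add: emode_def)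

lemma emode_periodic [simp]: "emode k (t + 2 * pi) = emode k t"
proof -
  have "emode k (t + 2 * pi) = emode k t * exp (of_int (2 * k) * (of_real pi * \<i>))"
    by (simp add: emode_def exp_add [symmetric] algebra_simps)
  also have "exp (of_int (2 * k) * (of_real pi * \<i>)) = 1"
    using exp_integer_2pi [of "of_int k"] by (simp add: algebra_simps)
  finally show ?thesis by simp
qed

lemma emode_deriv: "(emode k has_vector_derivative \<i> * of_int k * emode k t) (at t within S)"
  unfolding emode_def
  by (rule has_vector_derivative_real_field | (auto intro!: derivative_eq_intros)[1] )+

lemma continuous_on_emode [continuous_intros]:
  "continuous_on S g \<Longrightarrow> continuous_on S (\<lambda>x. emode k (g x))"
  unfolding emode_def by (intro continuous_intros)

lemma rapid_deriv: "rapid v \<Longrightarrow> (v k b has_vector_derivative v k (Suc b) x) (at x within S)"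
  unfolding rapid_def by (blast intro: has_vector_derivative_at_within)

lemma rapid_continuous:
  assumes "rapid v" shows "continuous_on S (v k b)"
  by (rule continuous_on_vector_derivative) (rule rapid_deriv [OF assms])

lemma rapid_bound:
  assumes "rapid v"
  obtains C where "C \<ge> 0" "\<And>k x. (1 + \<bar>of_int k\<bar>) ^ a * (1 + \<bar>x\<bar>) ^ c * norm (v k b x) \<le> C"
proof -
  obtain C where C: "\<And>k x. (1 + \<bar>of_int k\<bar>) ^ a * (1 + \<bar>x\<bar>) ^ c * norm (v k b x) \<le> C"
    using assms unfolding rapid_def by metis
  have "0 \<le> C" by (rule order_trans [OF _ C [of 0 0]]) simp
  then show ?thesis using C that by blast
qed

lemma rapidI:
  assumes "\<And>k b x. (v k b has_vector_derivative v k (Suc b) x) (at x)"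
    and "\<And>a b c. \<exists>C. \<forall>k x. (1 + \<bar>of_int k\<bar>) ^ a * (1 + \<bar>x\<bar>) ^ c * norm (v k b x) \<le> C"
  shows "rapid v"
  using assms unfolding rapid_def by blast

text \<open>The factor is constant in \<open>x\<close>, so it passes through every derivative, and
  its linear growth in \<open>k\<close> is paid for by one more power of the weight. This serves
  both the multiplier \<open>\<i> k\<close> of \<open>dt\<close> and division by the symbol.\<close>

lemma rapid_mult:
  assumes v: "rapid v" and A: "\<And>k. norm (m k) \<le> A * (1 + \<bar>of_int k\<bar>)"
  shows "rapid (\<lambda>k b x. m k * v k b x)"
proof (rule rapidI)
  fix k b x
  show "((\<lambda>x. m k * v k b x) has_vector_derivative m k * v k (Suc b) x) (at x)"
    by (rule has_vector_derivative_mult_right [OF rapid_deriv [OF v]])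
next
  fix a b c
  obtain C where C: "C \<ge> 0" "\<And>k x. (1 + \<bar>of_int k\<bar>) ^ Suc a * (1 + \<bar>x\<bar>) ^ c * norm (v k b x) \<le> C"
    using rapid_bound [OF v] by metis
  have "0 \<le> A" using order_trans [OF norm_ge_zero A [of 0]] by simp
  have "(1 + \<bar>of_int k\<bar>) ^ a * (1 + \<bar>x\<bar>) ^ c * norm (m k * v k b x) \<le> A * C" for k x
  proof -
    have "(1 + \<bar>of_int k\<bar>) ^ a * (1 + \<bar>x\<bar>) ^ c * norm (m k * v k b x)
        = norm (m k) * ((1 + \<bar>of_int k\<bar>) ^ a * (1 + \<bar>x\<bar>) ^ c * norm (v k b x))"
      by (simp add: norm_mult)
    also have "\<dots> \<le> (A * (1 + \<bar>of_int k\<bar>)) * ((1 + \<bar>of_int k\<bar>) ^ a * (1 + \<bar>x\<bar>) ^ c * norm (v k b x))"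
      by (intro mult_right_mono A) auto
    also have "\<dots> = A * ((1 + \<bar>of_int k\<bar>) ^ Suc a * (1 + \<bar>x\<bar>) ^ c * norm (v k b x))"
      by (simp add: algebra_simps)
    also have "\<dots> \<le> A * C" by (intro mult_left_mono C \<open>0 \<le> A\<close>)
    finally show ?thesis .
  qed
  then show "\<exists>C. \<forall>k x. (1 + \<bar>of_int k\<bar>) ^ a * (1 + \<bar>x\<bar>) ^ c * norm (m k * v k b x) \<le> C"
    by blast
qed

lemma rapid_shift: "rapid v \<Longrightarrow> rapid (\<lambda>k b. v k (Suc b))"
  unfolding rapid_def by blast

lemma rapid_dt: "rapid v \<Longrightarrow> rapid (\<lambda>k b x. \<i> * of_int k * v k b x)"
  by (rule rapid_mult [where A = 1]) (auto simp: norm_mult)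

section \<open>Convergence and termwise differentiation of the series\<close>

lemma summable_int_decode:
  "summable (\<lambda>n. C / (1 + \<bar>real_of_int (int_decode n)\<bar>) ^ 2)"
proof (rule summable_comparison_test' [where N = 0])
  show "summable (\<lambda>n. \<bar>C\<bar> * 4 * inverse (real (Suc n) ^ 2))"
    using inverse_power_summable [of 2, where 'a = real]
    by (intro summable_mult) (simp only: summable_Suc_iff [of "\<lambda>n. inverse (real n ^ 2)"] of_nat_id order_refl)
  fix n :: nat
  \<comment> \<open>\<open>int_decode\<close> alternates between nonnegative and negative integers,
    so its modulus is about \<open>n / 2\<close>; squaring the resulting factor 2 gives the 4 in the
    majorant.\<close>
  have "n + 1 \<le> 2 * (1 + \<bar>int_decode n\<bar>)"
    by (auto simp: int_decode_def sum_decode_def)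
  then have "real_of_int (int n + 1) \<le> real_of_int (2 * (1 + \<bar>int_decode n\<bar>))"
    by (simp only: of_int_le_iff)
  then have le: "real (Suc n) \<le> 2 * (1 + \<bar>real_of_int (int_decode n)\<bar>)" by simp
  define p q where "p = real (Suc n)" and "q = 1 + \<bar>real_of_int (int_decode n)\<bar>"
  have "p > 0" "q > 0" "p \<le> 2 * q" using le by (auto simp: p_def q_def)
  then have "1 / q \<le> 2 / p" by (simp add: field_simps)
  then have "(1 / q) ^ 2 \<le> (2 / p) ^ 2" using \<open>q > 0\<close> by (intro power_mono) auto
  then have "\<bar>C\<bar> * (1 / q) ^ 2 \<le> \<bar>C\<bar> * (2 / p) ^ 2" by (intro mult_left_mono) auto
  then show "norm (C / (1 + \<bar>real_of_int (int_decode n)\<bar>) ^ 2) \<le> \<bar>C\<bar> * 4 * inverse (real (Suc n) ^ 2)"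
    unfolding p_def [symmetric] q_def [symmetric]
    by (simp add: power_divide divide_inverse mult.assoc power_inverse abs_mult)
qed

text \<open>A majorant independent of \<open>x\<close> gives, by the M-test, uniform convergence of
  the differentiated series on the whole line, which is what termwise differentiation
  requires.\<close>

lemma has_vector_derivative_suminf:
  fixes f :: "nat \<Rightarrow> real \<Rightarrow> 'b :: banach"
  assumes d: "\<And>n x. (f n has_vector_derivative f' n x) (at x)"
    and s: "\<And>x. summable (\<lambda>n. f n x)"
    and b: "\<And>n x. norm (f' n x) \<le> M n" and M: "summable M"
  shows "((\<lambda>x. \<Sum>n. f n x) has_vector_derivative (\<Sum>n. f' n x)) (at x)"
proof -
  have u: "uniform_limit UNIV (\<lambda>n x. \<Sum>i<n. f' i x) (\<lambda>x. \<Sum>n. f' n x) sequentially"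
    by (rule Weierstrass_m_test [OF b M])
  have "\<exists>g. \<forall>x\<in>UNIV. (\<lambda>n. f n x) sums (g x) \<and> (g has_derivative (\<lambda>h. h *\<^sub>R (\<Sum>n. f' n x))) (at x within UNIV)"
  proof (rule has_derivative_series)
    show "(f n has_derivative (\<lambda>h. h *\<^sub>R f' n x)) (at x within UNIV)" for n x
      using d by (simp add: has_vector_derivative_def)
    show "(\<lambda>n. f n 0) sums (\<Sum>n. f n 0)" using s by (rule summable_sums)
    fix e :: real assume "e > 0"
    then have "\<forall>\<^sub>F n in sequentially. \<forall>x\<in>UNIV. dist (\<Sum>i<n. f' i x) (\<Sum>n. f' n x) < e"
      using u unfolding uniform_limit_iff by blast
    then show "\<forall>\<^sub>F n in sequentially. \<forall>x\<in>UNIV. \<forall>h. norm ((\<Sum>i<n. h *\<^sub>R f' i x) - h *\<^sub>R (\<Sum>n. f' n x)) \<le> e * norm h"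
    proof eventually_elim
      case (elim n)
      show ?case
      proof (intro ballI allI)
        fix x h
        have "norm ((\<Sum>i<n. h *\<^sub>R f' i x) - h *\<^sub>R (\<Sum>n. f' n x)) = \<bar>h\<bar> * norm ((\<Sum>i<n. f' i x) - (\<Sum>n. f' n x))"
          by (simp add: scaleR_sum_right [symmetric] scaleR_diff_right [symmetric])
        also have "\<dots> \<le> \<bar>h\<bar> * e"
          using elim by (intro mult_left_mono) (auto simp: dist_norm less_imp_le)
        finally show "norm ((\<Sum>i<n. h *\<^sub>R f' i x) - h *\<^sub>R (\<Sum>n. f' n x)) \<le> e * norm h"
          by (simp add: mult.commute)
      qed
    qed
  qed auto
  then obtain g where g: "\<And>x. (\<lambda>n. f n x) sums g x" "\<And>x. (g has_derivative (\<lambda>h. h *\<^sub>R (\<Sum>n. f' n x))) (at x)"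
    by auto
  have "g = (\<lambda>x. \<Sum>n. f n x)" using g(1) by (auto simp: sums_iff)
  then show ?thesis using g(2) by (simp add: has_vector_derivative_def)
qed

text \<open>Two powers of \<open>1 + |k|\<close> buy summability over the integers, while the weight
  in \<open>x\<close> stays on the left. The case \<open>c = 0\<close> serves continuity and
  differentiation, general \<open>c\<close> the Schwartz bounds.\<close>

lemma rapid_summable_majorant:
  assumes "rapid v"
  obtains M where "summable M"
    "\<And>n t x. (1 + \<bar>x\<bar>) ^ c * norm (emode (int_decode n) t * v (int_decode n) b x) \<le> M n"
proof -
  obtain C where C: "C \<ge> 0" "\<And>k x. (1 + \<bar>of_int k\<bar>) ^ 2 * (1 + \<bar>x\<bar>) ^ c * norm (v k b x) \<le> C"
    using rapid_bound [OF assms] by metis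
  show ?thesis
  proof (rule that [OF summable_int_decode])
    fix n t x
    show "(1 + \<bar>x\<bar>) ^ c * norm (emode (int_decode n) t * v (int_decode n) b x)
        \<le> C / (1 + \<bar>real_of_int (int_decode n)\<bar>) ^ 2"
      using C(2) [of "int_decode n" x] by (simp add: norm_mult field_simps)
  qed
qed

lemma rapid_majorant:
  assumes "rapid v"
  obtains M where "summable M"
    "\<And>n t x. norm (emode (int_decode n) t * v (int_decode n) b x) \<le> M n"
  using rapid_summable_majorant [OF assms, of 0 b] by auto

lemma rapid_summable:
  assumes "rapid v"
  shows "summable (\<lambda>n. emode (int_decode n) t * v (int_decode n) b x)"
proof -
  obtain M where "summable M"
    "\<And>n t x. norm (emode (int_decode n) t * v (int_decode n) b x) \<le> M n"
    using rapid_majorant [OF assms, of b] by blast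
  then show ?thesis by (rule summable_comparison_test')
qed

lemma fser_deriv_t:
  assumes v: "rapid v"
  shows "((\<lambda>s. fser v (s, x)) has_vector_derivative fser (\<lambda>k b x. \<i> * of_int k * v k b x) (t, x)) (at t)"
proof -
  obtain M where M: "summable M" "\<And>n t x. norm (emode (int_decode n) t * (\<i> * of_int (int_decode n) * v (int_decode n) 0 x)) \<le> M n"
    using rapid_majorant [OF rapid_dt [OF v], of 0] by metis
  show ?thesis unfolding fser_def prod.case
  proof (rule has_vector_derivative_suminf [OF _ rapid_summable [OF v] M(2,1)])
    fix n s
    show "((\<lambda>s. emode (int_decode n) s * v (int_decode n) 0 x) has_vector_derivative
       emode (int_decode n) s * (\<i> * of_int (int_decode n) * v (int_decode n) 0 x)) (at s)"
      using has_vector_derivative_mult_left [OF emode_deriv [of "int_decode n" s UNIV], of "v (int_decode n) 0 x"]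
      by (simp add: algebra_simps)
  qed
qed

lemma fser_deriv_x:
  assumes v: "rapid v"
  shows "((\<lambda>y. fser v (t, y)) has_vector_derivative fser (\<lambda>k b. v k (Suc b)) (t, x)) (at x)"
proof -
  obtain M where M: "summable M" "\<And>n t x. norm (emode (int_decode n) t * (v (int_decode n) (Suc 0) x)) \<le> M n"
    using rapid_majorant [OF v, of "Suc 0"] by metis
  show ?thesis unfolding fser_def prod.case
  proof (rule has_vector_derivative_suminf [OF _ rapid_summable [OF v] M(2,1)])
    fix n y
    show "((\<lambda>y. emode (int_decode n) t * v (int_decode n) 0 y) has_vector_derivative
       emode (int_decode n) t * v (int_decode n) (Suc 0) y) (at y)"
      by (rule has_vector_derivative_mult_right [OF rapid_deriv [OF v]])
  qed
qed

lemma fser_continuous: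
  assumes v: "rapid v"
  shows "continuous_on S (fser v)"
proof -
  obtain M where M: "summable M" "\<And>n t x. norm (emode (int_decode n) t * (v (int_decode n) 0 x)) \<le> M n"
    using rapid_majorant [OF v, of 0] by metis
  have "continuous_on UNIV (\<lambda>p. \<Sum>n. emode (int_decode n) (fst p) * v (int_decode n) 0 (snd p))"
  proof (rule uniform_limit_theorem [OF _ Weierstrass_m_test [OF M(2,1)]])
    show "\<forall>\<^sub>F n in sequentially. continuous_on UNIV
       (\<lambda>p. \<Sum>i<n. emode (int_decode i) (fst p) * v (int_decode i) 0 (snd p))"
      by (intro always_eventually allI continuous_intros
          continuous_on_compose2 [OF rapid_continuous [OF v, of UNIV]]) auto
  qed auto
  then show ?thesis
    unfolding fser_def case_prod_beta by (rule continuous_on_subset) auto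
qed

lemma dt_fser: "rapid v \<Longrightarrow> dt (fser v) = fser (\<lambda>k b x. \<i> * of_int k * v k b x)"
  by (auto simp: dt_def fun_eq_iff intro!: vector_derivative_at fser_deriv_t)

lemma dx_fser: "rapid v \<Longrightarrow> dx (fser v) = fser (\<lambda>k b. v k (Suc b))"
  by (auto simp: dx_def fun_eq_iff intro!: vector_derivative_at fser_deriv_x)

lemma pd_fser:
  assumes "rapid v"
  shows "\<exists>w. rapid w \<and> pd l (fser v) = fser w"
proof (induction l)
  case Nil
  then show ?case using assms by auto
next
  case (Cons a l)
  then obtain w where "rapid w" "pd l (fser v) = fser w" by blast
  then show ?case
    by (cases a) (auto simp: dt_fser dx_fser intro: rapid_dt rapid_shift)
qed

lemma fser_bounded:
  assumes v: "rapid v"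
  shows "\<exists>C. \<forall>t x. norm (of_real (x ^ c) * fser v (t, x)) \<le> C"
proof -
  obtain M where M: "summable M" "\<And>n t x. (1 + \<bar>x\<bar>) ^ c * norm (emode (int_decode n) t * (v (int_decode n) 0 x)) \<le> M n"
    using rapid_summable_majorant [OF v, of c 0] by metis
  have "norm (of_real (x ^ c) * fser v (t, x)) \<le> suminf M" for t x
  proof -
    have b: "norm (of_real (x ^ c) * (emode (int_decode n) t * v (int_decode n) 0 x)) \<le> M n" for n
    proof -
      have "norm (of_real (x ^ c) * (emode (int_decode n) t * v (int_decode n) 0 x))
          = \<bar>x\<bar> ^ c * norm (emode (int_decode n) t * v (int_decode n) 0 x)"
        by (simp add: norm_mult norm_power)
      also have "\<dots> \<le> (1 + \<bar>x\<bar>) ^ c * norm (emode (int_decode n) t * v (int_decode n) 0 x)"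
        by (intro mult_right_mono power_mono) auto
      finally show ?thesis using M(2) order_trans by blast
    qed
    have "of_real (x ^ c) * fser v (t, x) = (\<Sum>n. of_real (x ^ c) * (emode (int_decode n) t * v (int_decode n) 0 x))"
      unfolding fser_def prod.case by (rule suminf_mult [OF rapid_summable [OF v], symmetric])
    also have "norm \<dots> \<le> suminf M"
      by (rule norm_suminf_le [OF b M(1)])
    finally show ?thesis .
  qed
  then show ?thesis by blast
qed

text \<open>By \<open>pd_fser\<close> every word of derivatives of a series is again a series, so
  the statements about an undifferentiated series settle all orders at once.\<close>

lemma fser_schwartz:
  assumes v: "rapid v"
  shows "fser v \<in> schwartz_TR"
proof -
  have "smooth2 (fser v)" unfolding smooth2_def
  proof (intro allI)
    fix l
    obtain w where w: "rapid w" "pd l (fser v) = fser w" using pd_fser [OF v] by blast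
    show "continuous_on UNIV (pd l (fser v)) \<and>
        (\<forall>t x. (\<lambda>s. pd l (fser v) (s, x)) differentiable at t) \<and>
        (\<forall>t x. (\<lambda>y. pd l (fser v) (t, y)) differentiable at x)"
      unfolding w(2)
      using fser_continuous [OF w(1)] fser_deriv_t [OF w(1)] fser_deriv_x [OF w(1)]
      by (meson differentiableI_vector)
  qed
  moreover have "periodic_t (fser v)" by (simp add: periodic_t_def fser_def)
  moreover have "\<exists>C. \<forall>t x. norm (of_real (x ^ c) * pd l (fser v) (t, x)) \<le> C" for c l
    using pd_fser [OF v, of l] fser_bounded by metis
  ultimately show ?thesis unfolding schwartz_TR_def by blast
qed

lemma Lop_fser:
  assumes v: "rapid v"
  shows "Lop c1 c2 c3 (fser v) = fser (\<lambda>k b x. (\<i> * c1 * of_int k + c3) * v k b x + c2 * v k (Suc b) x)"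
proof
  fix p :: "real \<times> real"
  obtain t x where p: "p = (t, x)" by (cases p)
  let ?e = "\<lambda>n. emode (int_decode n) t"
  have s1: "summable (\<lambda>n. ?e n * (\<i> * of_int (int_decode n) * v (int_decode n) 0 x))"
    by (rule rapid_summable [OF rapid_dt [OF v]])
  note s2 = rapid_summable [OF v, of t "Suc 0" x] and s3 = rapid_summable [OF v, of t 0 x]
  have "Lop c1 c2 c3 (fser v) p =
     (\<Sum>n. c1 * (?e n * (\<i> * of_int (int_decode n) * v (int_decode n) 0 x)) + c2 * (?e n * v (int_decode n) (Suc 0) x)
         + c3 * (?e n * v (int_decode n) 0 x))"
    unfolding Lop_def dt_fser [OF v] dx_fser [OF v] p unfolding fser_def prod.case
    by (simp add: suminf_add [symmetric] suminf_mult [symmetric] summable_add summable_mult s1 s2 s3)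
  also have "\<dots> = fser (\<lambda>k b x. (\<i> * c1 * of_int k + c3) * v k b x + c2 * v k (Suc b) x) p"
    unfolding p fser_def prod.case by (intro suminf_cong) (simp add: algebra_simps)
  finally show "Lop c1 c2 c3 (fser v) p = \<dots>" .
qed

section \<open>Fourier coefficients in the periodic variable\<close>

lemma smooth2_pd_dt:
  assumes "smooth2 f"
  shows "((\<lambda>s. pd w f (s, x)) has_vector_derivative pd (True # w) f (t, x)) (at t)"
  using assms unfolding smooth2_def by (simp add: dt_def vector_derivative_works [symmetric])

lemma smooth2_pd_dx:
  assumes "smooth2 f"
  shows "((\<lambda>y. pd w f (t, y)) has_vector_derivative pd (False # w) f (t, x)) (at x)"
  using assms unfolding smooth2_def by (simp add: dx_def vector_derivative_works [symmetric])

lemma smooth2_pd_continuous: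
  assumes "smooth2 f"
  shows "continuous_on S (pd w f)"
  using assms continuous_on_subset unfolding smooth2_def by blast

text \<open>Makes the boundary terms in \<open>mcoef_dt\<close> cancel for derivatives of every
  order. A shift by the period has derivative 1, so the chain rule and uniqueness of derivatives
  carry periodicity through \<open>dt\<close>; under \<open>dx\<close> the functions being
  differentiated at the two points coincide.\<close>

lemma periodic_pd:
  assumes f: "smooth2 f" and p: "periodic_t f"
  shows "periodic_t (pd w f)"
proof (induction w)
  case Nil
  then show ?case using p by simp
next
  case (Cons a w)
  show ?case
  proof (cases a)
    case False
    then show ?thesis using Cons by (simp add: periodic_t_def dx_def)
  next
    case True
    have "pd (True # w) f (t + 2 * pi, x) = pd (True # w) f (t, x)" for t x
    proof -
      have "((\<lambda>s. pd w f (s, x)) \<circ> (\<lambda>s. s + 2 * pi) has_vector_derivative 1 *\<^sub>R pd (True # w) f (t + 2 * pi, x)) (at t)"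
        by (rule vector_diff_chain_at [OF _ smooth2_pd_dt [OF f]]) (auto intro!: derivative_eq_intros)
      moreover have "(\<lambda>s. pd w f (s, x)) \<circ> (\<lambda>s. s + 2 * pi) = (\<lambda>s. pd w f (s, x))"
        using Cons by (auto simp: periodic_t_def)
      ultimately have "((\<lambda>s. pd w f (s, x)) has_vector_derivative pd (True # w) f (t + 2 * pi, x)) (at t)"
        by simp
      then show ?thesis using smooth2_pd_dt [OF f] vector_derivative_unique_at by blast
    qed
    then show ?thesis using True by (simp add: periodic_t_def)
  qed
qed

definition mcoef :: "(real \<times> real \<Rightarrow> complex) \<Rightarrow> int \<Rightarrow> real \<Rightarrow> complex" where
  "mcoef f k x = (1 / (2 * of_real pi)) * integral {0..2*pi} (\<lambda>t. emode (- k) t * f (t, x))"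

text \<open>Differentiation under the integral sign over a compact interval, justified by joint
  continuity of the differentiated integrand.\<close>

lemma mcoef_deriv:
  assumes f: "smooth2 f"
  shows "(mcoef (pd w f) k has_vector_derivative mcoef (pd (False # w) f) k x) (at x)"
proof -
  have "((\<lambda>x. integral (cbox 0 (2*pi)) (\<lambda>t. emode (- k) t * pd w f (t, x))) has_vector_derivative
      integral (cbox 0 (2*pi)) (\<lambda>t. emode (- k) t * pd (False # w) f (t, x))) (at x within UNIV)"
  proof (rule leibniz_rule_vector_derivative)
    show "((\<lambda>x. emode (- k) t * pd w f (t, x)) has_vector_derivative emode (- k) t * pd (False # w) f (t, x)) (at x within UNIV)" for t x
      by (rule has_vector_derivative_mult_right [OF smooth2_pd_dx [OF f]])
    show "(\<lambda>t. emode (- k) t * pd w f (t, x)) integrable_on cbox 0 (2*pi)" for x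
      by (intro integrable_continuous continuous_intros
          continuous_on_compose2 [OF smooth2_pd_continuous [OF f, of UNIV w]]) auto
    show "continuous_on (UNIV \<times> cbox 0 (2*pi)) (\<lambda>(x, t). emode (- k) t * pd (False # w) f (t, x))"
      unfolding case_prod_beta
      by (intro continuous_intros continuous_on_compose2 [OF smooth2_pd_continuous [OF f, of UNIV "False # w"]]) auto
  qed auto
  then show ?thesis unfolding mcoef_def by (intro has_vector_derivative_mult_right) simp
qed

text \<open>Integration by parts: differentiating \<open>emode (- k)\<close> produces
  \<open>- \<i> k\<close>, and periodicity removes the boundary terms.\<close>

lemma mcoef_dt:
  assumes f: "smooth2 f" and p: "periodic_t f"
  shows "mcoef (pd (True # w) f) k x = \<i> * of_int k * mcoef (pd w f) k x"
proof -
  let ?F = "\<lambda>t. emode (- k) t * pd w f (t, x)"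
  have "((\<lambda>t. emode (- k) t * pd (True # w) f (t, x) - \<i> * of_int k * ?F t)
      has_integral (?F (2 * pi) - ?F 0)) {0..2*pi}"
  proof (rule fundamental_theorem_of_calculus)
    fix t
    show "(?F has_vector_derivative emode (- k) t * pd (True # w) f (t, x) - \<i> * of_int k * ?F t) (at t within {0..2*pi})"
      by (rule has_vector_derivative_eq_rhs
        [OF has_vector_derivative_mult [OF emode_deriv has_vector_derivative_at_within [OF smooth2_pd_dt [OF f]]]])
        (simp add: algebra_simps)
  qed simp
  moreover have "?F (2 * pi) = ?F 0"
    using periodic_pd [OF f p, of w] emode_periodic [of "- k" 0] by (auto simp: periodic_t_def dest: spec [of _ 0])
  ultimately have "((\<lambda>t. emode (- k) t * pd (True # w) f (t, x) - \<i> * of_int k * ?F t) has_integral 0) {0..2*pi}"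
    by simp
  moreover have i: "?F integrable_on {0..2*pi}" "(\<lambda>t. emode (- k) t * pd (True # w) f (t, x)) integrable_on {0..2*pi}"
    by (intro integrable_continuous_real continuous_intros
          continuous_on_compose2 [OF smooth2_pd_continuous [OF f, of UNIV w]]
          continuous_on_compose2 [OF smooth2_pd_continuous [OF f, of UNIV "True # w"]]; force)+
  ultimately have "integral {0..2*pi} (\<lambda>t. emode (- k) t * pd (True # w) f (t, x)) - \<i> * of_int k * integral {0..2*pi} ?F = 0"
    by (subst integral_mult_right [symmetric], subst integral_diff [symmetric])
      (auto intro!: integral_unique integrable_on_mult_right)
  then show ?thesis unfolding mcoef_def by simp
qed

lemma mcoef_bound:
  assumes c: "continuous_on UNIV f" and B: "\<And>t. norm (f (t, x)) \<le> B"
  shows "norm (mcoef f k x) \<le> B"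
proof -
  have "norm (integral {0..2*pi} (\<lambda>t. emode (- k) t * f (t, x))) \<le> B * (2 * pi - 0)"
    by (rule integral_bound)
      (auto simp: norm_mult B intro!: continuous_intros continuous_on_compose2 [OF c])
  then show ?thesis unfolding mcoef_def by (simp add: norm_mult norm_divide field_simps)
qed

text \<open>Used to pass from the monomial seminorms of \<open>schwartz_TR\<close> to the weights of
  \<open>rapid\<close>.\<close>

lemma one_plus_power_le:
  fixes s :: real
  assumes "s \<ge> 0"
  shows "(1 + s) ^ n \<le> 2 ^ n * (1 + s ^ n)"
proof -
  have "(1 + s) ^ n \<le> (2 * max 1 s) ^ n" using assms by (intro power_mono) auto
  also have "\<dots> \<le> 2 ^ n * (1 + s ^ n)"
    unfolding power_mult_distrib using assms by (intro mult_left_mono) (auto simp: max_def)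
  finally show ?thesis .
qed

text \<open>The coefficient of the \<open>b\<close>-th \<open>x\<close>-derivative stands in for the
  \<open>b\<close>-th derivative of the coefficient, which is the format of \<open>rapid\<close>;
  \<open>mcoef_deriv\<close> justifies this.\<close>

definition fcoef :: "(real \<times> real \<Rightarrow> complex) \<Rightarrow> int \<Rightarrow> nat \<Rightarrow> real \<Rightarrow> complex" where
  "fcoef f k b = mcoef (pd (replicate b False) f) k"

lemma mcoef_dt_power:
  assumes f: "smooth2 f" and p: "periodic_t f"
  shows "mcoef (pd (replicate a True @ w) f) k x = (\<i> * of_int k) ^ a * mcoef (pd w f) k x"
  by (induction a) (use mcoef_dt [OF f p] in \<open>auto simp del: pd.simps\<close>)

text \<open>A factor \<open>(\<i> k) ^ a\<close> is absorbed by \<open>a\<close> derivatives in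
  \<open>t\<close>, and \<open>x ^ c\<close> moves inside the integral, so a weighted coefficient is
  bounded by a Schwartz seminorm. In \<open>schwartz_TR\<close> the \<open>t\<close>-derivatives are
  outermost, just where \<open>mcoef_dt_power\<close> peels them off.\<close>

lemma rapid_fcoef:
  assumes "f \<in> schwartz_TR"
  shows "rapid (fcoef f)"
proof (rule rapidI)
  have f: "smooth2 f" and p: "periodic_t f"
    and bd: "\<And>a b c. \<exists>C. \<forall>t x. norm (of_real (x ^ c) * pd (replicate a True @ replicate b False) f (t, x)) \<le> C"
    using assms unfolding schwartz_TR_def by blast+
  show "(fcoef f k b has_vector_derivative fcoef f k (Suc b) x) (at x)" for k b x
    using mcoef_deriv [OF f, of "replicate b False"] by (simp add: fcoef_def)
  have key: "\<exists>C. \<forall>k x. \<bar>of_int k\<bar> ^ a * \<bar>x\<bar> ^ c * norm (fcoef f k b x) \<le> C" for a b c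
  proof -
    obtain C where C: "\<And>t x. norm (of_real (x ^ c) * pd (replicate a True @ replicate b False) f (t, x)) \<le> C"
      using bd by metis
    have "\<bar>of_int k\<bar> ^ a * \<bar>x\<bar> ^ c * norm (fcoef f k b x) \<le> C" for k x
    proof -
      have "\<bar>of_int k\<bar> ^ a * \<bar>x\<bar> ^ c * norm (fcoef f k b x)
          = norm (of_real (x ^ c) * ((\<i> * of_int k) ^ a * mcoef (pd (replicate b False) f) k x))"
        by (simp add: norm_mult norm_power fcoef_def)
      also have "(\<i> * of_int k) ^ a * mcoef (pd (replicate b False) f) k x
          = mcoef (pd (replicate a True @ replicate b False) f) k x"
        by (rule mcoef_dt_power [OF f p, symmetric])
      also have "of_real (x ^ c) * \<dots> = mcoef (\<lambda>(t, x). of_real (x ^ c) * pd (replicate a True @ replicate b False) f (t, x)) k x"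
        unfolding mcoef_def prod.case integral_mult_right [symmetric] by (simp add: algebra_simps)
      also have "norm \<dots> \<le> C"
        using C by (intro mcoef_bound) (auto simp: case_prod_beta intro!: continuous_intros smooth2_pd_continuous [OF f])
      finally show ?thesis .
    qed
    then show ?thesis by blast
  qed
  fix a b c
  \<comment> \<open>Expanding \<open>(1 + |k| ^ a) (1 + |x| ^ c)\<close> leaves four products, each
    an instance of \<open>key\<close>.\<close>
  obtain C0 C1 C2 C3 where C:
    "\<And>k x. \<bar>of_int k\<bar> ^ 0 * \<bar>x\<bar> ^ 0 * norm (fcoef f k b x) \<le> C0"
    "\<And>k x. \<bar>of_int k\<bar> ^ a * \<bar>x\<bar> ^ 0 * norm (fcoef f k b x) \<le> C1"
    "\<And>k x. \<bar>of_int k\<bar> ^ 0 * \<bar>x\<bar> ^ c * norm (fcoef f k b x) \<le> C2"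
    "\<And>k x. \<bar>of_int k\<bar> ^ a * \<bar>x\<bar> ^ c * norm (fcoef f k b x) \<le> C3"
    using key by metis
  have "(1 + \<bar>of_int k\<bar>) ^ a * (1 + \<bar>x\<bar>) ^ c * norm (fcoef f k b x) \<le> (2 ^ a * 2 ^ c) * (C0 + C1 + C2 + C3)" for k x
  proof -
    have "(1 + \<bar>of_int k\<bar>) ^ a * (1 + \<bar>x\<bar>) ^ c * norm (fcoef f k b x)
        \<le> (2 ^ a * (1 + \<bar>of_int k\<bar> ^ a)) * (2 ^ c * (1 + \<bar>x\<bar> ^ c)) * norm (fcoef f k b x)"
      by (intro mult_right_mono mult_mono one_plus_power_le) auto
    also have "\<dots> = (2 ^ a * 2 ^ c) * (norm (fcoef f k b x) + \<bar>of_int k\<bar> ^ a * norm (fcoef f k b x)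
        + \<bar>x\<bar> ^ c * norm (fcoef f k b x) + \<bar>of_int k\<bar> ^ a * \<bar>x\<bar> ^ c * norm (fcoef f k b x))"
      by (simp add: algebra_simps)
    also have "\<dots> \<le> (2 ^ a * 2 ^ c) * (C0 + C1 + C2 + C3)"
      using C(1-3) [of k x] C(4) [of k x] by (intro mult_left_mono add_mono) auto
    finally show ?thesis .
  qed
  then show "\<exists>C. \<forall>k x. (1 + \<bar>of_int k\<bar>) ^ a * (1 + \<bar>x\<bar>) ^ c * norm (fcoef f k b x) \<le> C" by blast
qed

section \<open>Orthogonality and completeness of the exponentials\<close>

lemma integral_emode: "integral {0..2*pi} (emode k) = (if k = 0 then 2 * of_real pi else 0)"
proof (cases "k = 0")
  case True
  have "emode 0 = (\<lambda>t. 1)" by auto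
  then show ?thesis using True by (simp add: scaleR_conv_of_real)
next
  case False
  have "((\<lambda>t. \<i> * of_int k * emode k t) has_integral (emode k (2*pi) - emode k 0)) {0..2*pi}"
    by (rule fundamental_theorem_of_calculus) (auto intro: emode_deriv)
  then have "((\<lambda>t. \<i> * of_int k * emode k t) has_integral 0) {0..2*pi}"
    using emode_periodic [of k 0] by simp
  then have "integral {0..2*pi} (\<lambda>t. \<i> * of_int k * emode k t) = 0" by (rule integral_unique)
  then show ?thesis using False by simp
qed

text \<open>Uniform convergence in \<open>t\<close> permits integration term by term, and
  orthogonality leaves only the mode \<open>m\<close>.\<close>

lemma integral_emode_fser:
  assumes v: "rapid v"
  shows "integral {0..2*pi} (\<lambda>t. emode (- m) t * fser v (t, x)) = 2 * of_real pi * v m 0 x"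
proof -
  obtain M where M: "summable M" "\<And>n t x. norm (emode (int_decode n) t * (v (int_decode n) 0 x)) \<le> M n"
    using rapid_majorant [OF v, of 0] by metis
  let ?T = "\<lambda>n t. emode (- m) t * (emode (int_decode n) t * v (int_decode n) 0 x)"
  have u: "uniform_limit (cbox 0 (2*pi)) (\<lambda>n t. \<Sum>i<n. ?T i t) (\<lambda>t. \<Sum>i. ?T i t) sequentially"
    by (rule Weierstrass_m_test [OF _ M(1)]) (use M(2) in \<open>simp add: norm_mult\<close>)
  obtain I J where IJ: "\<And>n. ((\<lambda>t. \<Sum>i<n. ?T i t) has_integral I n) (cbox 0 (2*pi))"
     "((\<lambda>t. \<Sum>i. ?T i t) has_integral J) (cbox 0 (2*pi))" "I \<longlonglongrightarrow> J"
    by (rule uniform_limit_integral_cbox [OF u]) (auto intro!: continuous_intros)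
  have T: "(?T n has_integral (if n = int_encode m then 2 * of_real pi * v m 0 x else 0)) {0..2*pi}" for n
  proof -
    have "(emode (int_decode n - m) has_integral (if int_decode n - m = 0 then 2 * of_real pi else 0)) {0..2*pi}"
      unfolding integral_emode [symmetric]
      by (intro integrable_integral integrable_continuous_real continuous_on_emode [where g = "\<lambda>x. x"] continuous_intros)
    then have "((\<lambda>t. emode (int_decode n - m) t * v (int_decode n) 0 x) has_integral (if int_decode n - m = 0 then 2 * of_real pi else 0) * v (int_decode n) 0 x) {0..2*pi}"
      by (rule has_integral_mult_left)
    also have "(\<lambda>t. emode (int_decode n - m) t * v (int_decode n) 0 x) = ?T n"
      using emode_add [of "- m" "int_decode n"] by (auto simp: mult.assoc)
    also have "(if int_decode n - m = 0 then 2 * of_real pi else 0) * v (int_decode n) 0 x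
        = (if n = int_encode m then 2 * of_real pi * v m 0 x else 0)"
      by auto
    finally show ?thesis .
  qed
  \<comment> \<open>The integrated partial sums are constant once they include the index
    \<open>int_encode m\<close> of the surviving mode.\<close>
  have I: "I n = 2 * of_real pi * v m 0 x" if "n > int_encode m" for n
  proof -
    have "((\<lambda>t. \<Sum>i<n. ?T i t) has_integral (\<Sum>i<n. if i = int_encode m then 2 * of_real pi * v m 0 x else 0)) {0..2*pi}"
      by (intro has_integral_sum T) auto
    then have "((\<lambda>t. \<Sum>i<n. ?T i t) has_integral 2 * of_real pi * v m 0 x) {0..2*pi}"
      using that by simp
    then show ?thesis using IJ(1) [of n] by (auto dest: has_integral_unique)
  qed
  have "I \<longlonglongrightarrow> 2 * of_real pi * v m 0 x"
    by (rule tendsto_eventually) (rule eventually_mono [OF eventually_gt_at_top I])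
  then have "J = 2 * of_real pi * v m 0 x" using IJ(3) LIMSEQ_unique by blast
  moreover have "(\<lambda>t. \<Sum>i. ?T i t) = (\<lambda>t. emode (- m) t * fser v (t, x))"
    unfolding fser_def prod.case by (intro ext suminf_mult rapid_summable [OF v])
  ultimately show ?thesis using IJ(2) by (simp add: integral_unique)
qed

text \<open>A continuous function on the circle orthogonal to all exponentials is orthogonal to all
  polynomials in the real coordinates of the circle, hence (Stone--Weierstrass) to itself.\<close>

lemma orthogonal_polynomial:
  fixes h :: "real \<Rightarrow> complex"
  assumes h: "continuous_on UNIV h" and q: "real_polynomial_function q"
  shows "\<lbrakk>continuous_on UNIV w; \<And>m. integral {0..2*pi} (\<lambda>t. emode m t * (h t * w t)) = 0\<rbrakk> \<Longrightarrow>
    continuous_on UNIV (\<lambda>t. of_real (q (cis t)) * w t) \<and>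
    (\<forall>m. integral {0..2*pi} (\<lambda>t. emode m t * (h t * (of_real (q (cis t)) * w t))) = 0)"
  using q
\<comment> \<open>The weight \<open>w\<close> stays arbitrary for the product case: the hypothesis
  for \<open>p\<close> is applied with weight \<open>q w\<close>, whose orthogonality is the
  hypothesis for \<open>q\<close>.\<close>
proof (induction q arbitrary: w rule: real_polynomial_function.induct)
  case (linear l)
  have i: "(\<lambda>t. emode m t * (h t * w t)) integrable_on {0..2*pi}" for m
    by (intro integrable_continuous_real continuous_intros continuous_on_subset [OF h] continuous_on_subset [OF linear(2)]) auto
  \<comment> \<open>On the circle a real-linear \<open>l\<close> equals
    \<open>l 1 cos t + l \<i> sin t\<close>; \<open>a\<close> and \<open>b\<close> are its
    coefficients with respect to \<open>emode 1\<close> and \<open>emode (- 1)\<close>, so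
    multiplication by \<open>l\<close> only shifts \<open>m\<close> by one.\<close>
  define a where "a = (complex_of_real (l 1) - \<i> * complex_of_real (l \<i>)) / 2"
  define b where "b = (complex_of_real (l 1) + \<i> * complex_of_real (l \<i>)) / 2"
  have l: "complex_of_real (l (cis t)) = a * emode 1 t + b * emode (- 1) t" for t
  proof -
    have "cis t = cos t *\<^sub>R 1 + sin t *\<^sub>R \<i>" by (simp add: complex_eq_iff)
    then have "l (cis t) = cos t * l 1 + sin t * l \<i>"
      using linear(1) by (simp add: bounded_linear.linear linear_add linear_scale)
    moreover have "emode 1 t = cis t" "emode (- 1) t = cis (- t)"
      by (simp_all add: emode_def cis_conv_exp)
    ultimately show ?thesis by (simp add: a_def b_def complex_eq_iff field_simps)
  qed
  have "continuous_on UNIV (\<lambda>t. complex_of_real (l (cis t)) * w t)"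
    unfolding l by (intro continuous_intros linear)
  moreover have "integral {0..2*pi} (\<lambda>t. emode m t * (h t * (of_real (l (cis t)) * w t))) = 0" for m
  proof -
    have "(\<lambda>t. emode m t * (h t * (of_real (l (cis t)) * w t)))
        = (\<lambda>t. a * (emode (m + 1) t * (h t * w t)) + b * (emode (m + (- 1)) t * (h t * w t)))"
      unfolding l emode_add by (auto simp: algebra_simps)
    then show ?thesis
      using linear(3) i by (simp add: integral_add integrable_on_mult_right)
  qed
  ultimately show ?case by blast
next
  case (const c)
  have "(\<lambda>t. emode m t * (h t * (of_real c * w t))) = (\<lambda>t. of_real c * (emode m t * (h t * w t)))" for m
    by (auto simp: algebra_simps)
  then show ?case using const by (auto intro!: continuous_intros)
next
  case (add p q)
  note P = add(3) [OF add(5,6)] and Q = add(4) [OF add(5,6)]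
  have ii: "(\<lambda>t. emode m t * (h t * u t)) integrable_on {0..2*pi}" if "continuous_on UNIV u" for u m
    by (intro integrable_continuous_real continuous_on_mult continuous_on_emode continuous_on_id
        continuous_on_subset [OF h] continuous_on_subset [OF that]) auto
  note i = ii [OF conjunct1 [OF P]] ii [OF conjunct1 [OF Q]]
  have "(\<lambda>t. complex_of_real (p (cis t) + q (cis t)) * w t) = (\<lambda>t. of_real (p (cis t)) * w t + of_real (q (cis t)) * w t)"
    by (auto simp: algebra_simps)
  moreover have "(\<lambda>t. emode m t * (h t * (of_real (p (cis t) + q (cis t)) * w t))) =
    (\<lambda>t. emode m t * (h t * (of_real (p (cis t)) * w t)) + emode m t * (h t * (of_real (q (cis t)) * w t)))" for m
    by (auto simp: algebra_simps)
  moreover note continuous_on_add [OF conjunct1 [OF P] conjunct1 [OF Q]]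
  ultimately show ?case using P Q i by (simp only: integral_add) simp
next
  case (mult p q)
  note Q = mult(4) [OF mult(5,6)]
  have "continuous_on UNIV (\<lambda>t. of_real (p (cis t)) * (of_real (q (cis t)) * w t)) \<and>
    (\<forall>m. integral {0..2*pi} (\<lambda>t. emode m t * (h t * (of_real (p (cis t)) * (of_real (q (cis t)) * w t)))) = 0)"
    using Q by (intro mult(3)) auto
  then show ?case by (simp add: mult.assoc)
qed

text \<open>Stone--Weierstrass needs a compact domain, so \<open>h\<close> is transported to a
  function \<open>H\<close> on the unit circle. Polynomials approximating \<open>cnj H\<close> are
  orthogonal to \<open>h\<close>, which forces the integral \<open>K\<close> of the squared modulus
  of \<open>h\<close> over a period to vanish.\<close>

lemma Fourier_series_unique:
  fixes h :: "real \<Rightarrow> complex"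
  assumes h: "continuous_on UNIV h" and p: "\<And>t. h (t + 2 * pi) = h t"
    and z: "\<And>m. integral {0..2*pi} (\<lambda>t. emode m t * h t) = 0"
  shows "h t = 0"
proof -
  have ch: "continuous_on S h" for S using h continuous_on_subset by blast
  define H where "H = (h \<circ> (\<lambda>s. 2 * pi * s)) \<circ> (\<lambda>z. Arg2pi z / (2 * pi))"
  \<comment> \<open>\<open>Arg2pi\<close> jumps at 1, where continuity of \<open>H\<close> rests on
    \<open>h 0 = h (2 * pi)\<close>. It is obtained by viewing \<open>h\<close> as a loop homotopic
    to itself and reading this homotopy as one of circle maps.\<close>
  have "path (h \<circ> (\<lambda>s. 2 * pi * s))"
    unfolding path_def by (intro continuous_on_compose continuous_intros ch)
  then have "homotopic_loops UNIV (h \<circ> (\<lambda>s. 2 * pi * s)) (h \<circ> (\<lambda>s. 2 * pi * s))"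
    using p [of 0] by (simp add: homotopic_loops_refl pathstart_def pathfinish_def)
  from homotopic_with_imp_continuous [OF homotopic_loops_imp_homotopic_circlemaps [OF this]]
  have cH: "continuous_on (sphere 0 1) H" unfolding H_def by blast
  have H: "H (cis t) = h t" if "t \<in> {0..2*pi}" for t
  proof (cases "t = 2 * pi")
    case True
    moreover have "Arg2pi 1 = 0" by (rule Arg2pi_unique [of 1]) auto
    ultimately show ?thesis using p [of 0] by (simp add: H_def)
  next
    case False
    then have "Arg2pi (cis t) = t"
      using that by (intro Arg2pi_unique [of 1]) (auto simp: cis_conv_exp)
    then show ?thesis by (simp add: H_def)
  qed
  have "compact (h ` {0..2*pi})" by (intro compact_continuous_image ch) auto
  then obtain B where B: "B > 0" "\<And>t. t \<in> {0..2*pi} \<Longrightarrow> norm (h t) \<le> B"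
    using compact_imp_bounded bounded_pos by (metis imageI)
  define K where "K = integral {0..2*pi} (\<lambda>t. h t * cnj (h t))"
  have small: "norm K \<le> B * e * (2 * pi)" if "e > 0" for e
  proof -
    have "\<exists>g. polynomial_function g \<and> (\<forall>z \<in> sphere 0 1. norm (cnj (H z) - g z) < e)"
      by (rule Stone_Weierstrass_polynomial_function) (auto intro: continuous_on_cnj cH that)
    then obtain g where g: "polynomial_function g" "\<And>z. z \<in> sphere 0 1 \<Longrightarrow> norm (cnj (H z) - g z) < e"
      by blast
    have "real_polynomial_function (Re \<circ> g)" "real_polynomial_function (Im \<circ> g)"
      using g(1) bounded_linear_Re bounded_linear_Im unfolding polynomial_function_def by blast+
    \<comment> \<open>With the constant weight 1 the hypothesis \<open>z\<close> is the starting
      point. Real and imaginary parts are separate because \<open>orthogonal_polynomial\<close>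
      concerns real polynomials.\<close>
    note * = this [THEN orthogonal_polynomial [OF h, of _ "\<lambda>_. 1"], simplified, OF z]
    have cg: "continuous_on UNIV (\<lambda>t. g (cis t))"
    proof -
      have "continuous_on UNIV (\<lambda>t. complex_of_real (Re (g (cis t))) + \<i> * complex_of_real (Im (g (cis t))))"
        using * by (auto intro!: continuous_intros)
      then show ?thesis by (simp only: complex_eq [symmetric])
    qed
    have i0: "(\<lambda>t. h t * g (cis t)) integrable_on {0..2*pi}" "(\<lambda>t. h t * cnj (h t)) integrable_on {0..2*pi}"
      by (auto intro!: integrable_continuous_real continuous_intros ch continuous_on_subset [OF cg])
    have "integral {0..2*pi} (\<lambda>t. h t * g (cis t)) = 0"
    proof -
      have "(\<lambda>t. h t * g (cis t)) = (\<lambda>t. emode 0 t * (h t * of_real (Re (g (cis t)))) + \<i> * (emode 0 t * (h t * of_real (Im (g (cis t))))))"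
        by (auto simp: complex_eq_iff)
      moreover have "(\<lambda>t. emode 0 t * (h t * of_real (Re (g (cis t))))) integrable_on {0..2*pi}"
        "(\<lambda>t. emode 0 t * (h t * of_real (Im (g (cis t))))) integrable_on {0..2*pi}"
        using * by (auto intro!: integrable_continuous_real continuous_intros ch continuous_on_subset [OF cg])
      ultimately show ?thesis
        using conjunct2 [OF *(1), rule_format, of 0] conjunct2 [OF *(2), rule_format, of 0]
        by (simp only: integral_add integrable_on_mult_right integral_mult_right) simp
    qed
    then have "K = integral {0..2*pi} (\<lambda>t. h t * (cnj (h t) - g (cis t)))"
      unfolding K_def using i0 by (simp add: right_diff_distrib integral_diff)
    also have "norm \<dots> \<le> B * e * (2 * pi - 0)"
    proof (rule integral_bound)
      fix t assume t: "t \<in> {0..2*pi}"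
      have "norm (cnj (h t) - g (cis t)) < e" using g(2) [of "cis t"] H [OF t] by simp
      then show "norm (h t * (cnj (h t) - g (cis t))) \<le> B * e"
        unfolding norm_mult using B t that by (intro mult_mono) auto
    qed (auto intro!: continuous_intros ch continuous_on_subset [OF cg])
    finally show ?thesis by simp
  qed
  have "norm K \<le> 0"
  proof (rule field_le_epsilon)
    fix e :: real assume "e > 0"
    then show "norm K \<le> 0 + e" using small [of "e / (B * (2 * pi))"] B(1) by simp
  qed
  then have "K = 0" by simp
  have "K = of_real (integral {0..2*pi} (\<lambda>t. (norm (h t))\<^sup>2))"
    unfolding K_def complex_norm_square [symmetric]
    by (rule integral_unique [OF has_integral_of_real [OF integrable_integral]])
      (auto intro!: integrable_continuous_real continuous_intros ch)
  with \<open>K = 0\<close> have i: "integral {0..2*pi} (\<lambda>t. (norm (h t))\<^sup>2) = 0" by simp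
  have h0: "h s = 0" if "s \<in> {0..2*pi}" for s
  proof -
    have "integral {0..2*pi} (\<lambda>t. (norm (h t))\<^sup>2) = 0 \<longleftrightarrow> (\<forall>t \<in> {0..2*pi}. (norm (h t))\<^sup>2 = 0)"
      by (rule integral_eq_0_iff) (auto intro!: continuous_intros ch)
    with i that show ?thesis by simp
  qed
  interpret periodic_fun_simple h "2 * pi" by unfold_locales (rule p)
  define s where "s = t + of_int (- \<lfloor>t / (2 * pi)\<rfloor>) * (2 * pi)"
  have "h t = h s" unfolding s_def by (rule plus_of_int [symmetric])
  moreover have "s \<in> {0..2*pi}"
  proof -
    have "of_int \<lfloor>t / (2 * pi)\<rfloor> * (2 * pi) \<le> t" "t < (of_int \<lfloor>t / (2 * pi)\<rfloor> + 1) * (2 * pi)"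
      using floor_divide_lower [of "2 * pi" t] floor_divide_upper [of "2 * pi" t] by simp_all
    then show ?thesis unfolding s_def by (simp add: distrib_right)
  qed
  ultimately show ?thesis using h0 by simp
qed

text \<open>For each fixed \<open>x\<close> the difference of the two sides is continuous and
  periodic in \<open>t\<close>, and all its Fourier coefficients vanish.\<close>

lemma fser_fcoef:
  assumes f: "f \<in> schwartz_TR"
  shows "fser (fcoef f) = f"
proof -
  have sf: "smooth2 f" and p: "periodic_t f" using f by (auto simp: schwartz_TR_def)
  have cf: "continuous_on UNIV f" using smooth2_pd_continuous [OF sf, of UNIV "[]"] by simp
  note v = rapid_fcoef [OF f]
  have "f (t, x) - fser (fcoef f) (t, x) = 0" for t x
  proof (rule Fourier_series_unique [where h = "\<lambda>t. f (t, x) - fser (fcoef f) (t, x)"])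
    have c1: "continuous_on S (\<lambda>t. f (t, x))" "continuous_on S (\<lambda>t. fser (fcoef f) (t, x))" for S
      by (intro continuous_on_compose2 [OF cf] continuous_on_compose2 [OF fser_continuous [OF v, of UNIV]] continuous_intros; simp)+
    then show "continuous_on UNIV (\<lambda>t. f (t, x) - fser (fcoef f) (t, x))"
      by (intro continuous_intros)
    show "f (t + 2 * pi, x) - fser (fcoef f) (t + 2 * pi, x) = f (t, x) - fser (fcoef f) (t, x)" for t
      using p by (simp add: periodic_t_def fser_def)
    fix m
    have i: "(\<lambda>t. emode m t * f (t, x)) integrable_on {0..2*pi}" "(\<lambda>t. emode m t * fser (fcoef f) (t, x)) integrable_on {0..2*pi}"
      by (intro integrable_continuous_real continuous_intros c1)+
    have "integral {0..2*pi} (\<lambda>t. emode m t * f (t, x)) = 2 * of_real pi * fcoef f (- m) 0 x"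
      by (simp add: fcoef_def mcoef_def)
    also have "\<dots> = integral {0..2*pi} (\<lambda>t. emode m t * fser (fcoef f) (t, x))"
      using integral_emode_fser [OF v, of "- m" x] by simp
    finally show "integral {0..2*pi} (\<lambda>t. emode m t * (f (t, x) - fser (fcoef f) (t, x))) = 0"
      using i by (simp add: right_diff_distrib integral_diff)
  qed
  then show ?thesis by auto
qed

section \<open>The ordinary differential equation on the line\<close>

lemma integrable_decay: "integrable lborel (\<lambda>y::real. 1 / (1 + \<bar>y\<bar>) ^ 2)"
proof (rule Bochner_Integration.integrable_bound)
  show "integrable lborel (\<lambda>y::real. inverse (1 + y ^ 2))"
    using integrable_inverse_1_plus_square by (simp add: set_integrable_def)
  show "AE y::real in lborel. norm (1 / (1 + \<bar>y\<bar>) ^ 2) \<le> norm (inverse (1 + y ^ 2))"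
  proof (rule AE_I2)
    fix y :: real
    have "1 + y ^ 2 \<le> (1 + \<bar>y\<bar>) ^ 2" by (simp add: power2_sum)
    moreover have "0 < 1 + y ^ 2" by (simp add: add_pos_nonneg)
    ultimately have "inverse ((1 + \<bar>y\<bar>) ^ 2) \<le> inverse (1 + y ^ 2)" by (intro le_imp_inverse_le)
    then show "norm (1 / (1 + \<bar>y\<bar>) ^ 2) \<le> norm (inverse (1 + y ^ 2))"
      by (simp add: divide_inverse power_inverse)
  qed
qed simp

text \<open>The price of reserving two powers of the weight for integration over the line.\<close>

definition decay_mass :: real where
  "decay_mass = (LINT y|lborel. 1 / (1 + \<bar>y\<bar>) ^ 2)"

text \<open>\<open>S\<close> is left general because half-lines in both directions and the whole
  line all occur; extending by zero bounds every case by the same integral.\<close>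

lemma set_integral_decay:
  fixes F :: "real \<Rightarrow> complex"
  assumes F: "continuous_on UNIV F" and S: "S \<in> sets borel" and D: "D \<ge> 0"
    and b: "\<And>y. y \<in> S \<Longrightarrow> norm (F y) \<le> D * (1 / (1 + \<bar>y\<bar>) ^ 2)"
  shows "set_integrable lborel S F" and "norm (LINT y:S|lborel. F y) \<le> D * decay_mass"
proof -
  have i: "integrable lborel (\<lambda>y. D * (1 / (1 + \<bar>y\<bar>) ^ 2))"
    by (intro integrable_mult_right integrable_decay)
  have m: "(\<lambda>y. indicator S y *\<^sub>R F y) \<in> borel_measurable lborel"
    using S borel_measurable_continuous_onI [OF F] by (intro borel_measurable_scaleR) auto
  have le: "norm (indicator S y *\<^sub>R F y) \<le> D * (1 / (1 + \<bar>y\<bar>) ^ 2)" for y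
    using b [of y] D by (auto simp: indicator_def)
  show "set_integrable lborel S F" unfolding set_integrable_def
    by (rule Bochner_Integration.integrable_bound [OF i m]) (use le D in auto)
  have "norm (LINT y:S|lborel. F y) \<le> (LINT y|lborel. D * (1 / (1 + \<bar>y\<bar>) ^ 2))"
    unfolding set_lebesgue_integral_def
    by (rule Bochner_Integration.integral_norm_bound_integral [OF _ i le])
       (use \<open>set_integrable lborel S F\<close> in \<open>simp add: set_integrable_def\<close>)
  also have "\<dots> = D * decay_mass" by (simp add: decay_mass_def del: times_divide_eq_right)
  finally show "norm (LINT y:S|lborel. F y) \<le> D * decay_mass" .
qed

section \<open>The integral solution and its decay\<close>

lemma set_integral_atMost_deriv:
  fixes F :: "real \<Rightarrow> complex"
  assumes F: "continuous_on UNIV F" and i: "\<And>x. set_integrable lborel {..x} F"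
  shows "((\<lambda>x. LINT y:{..x}|lborel. F y) has_vector_derivative F x) (at x)"
proof -
  \<comment> \<open>Cutting at a fixed point left of \<open>x\<close> splits off a constant and
    leaves an integral over a compact interval, to which the fundamental theorem applies.\<close>
  define a where "a = x - 1"
  have eq: "(LINT y:{..u}|lborel. F y) = (LINT y:{..<a}|lborel. F y) + integral {a..u} F" if "u \<ge> a" for u
  proof -
    have "{..u} = {..<a} \<union> {a..u}" using that by auto
    moreover have "set_integrable lborel {..<a} F" "set_integrable lborel {a..u} F"
      by (rule set_integrable_subset [OF i [of "max a u"]]; force)+
    ultimately have "(LINT y:{..u}|lborel. F y) = (LINT y:{..<a}|lborel. F y) + (LINT y:{a..u}|lborel. F y)"
      by (simp only:) (rule set_integral_Un, auto)
    then show ?thesis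
      using \<open>set_integrable lborel {a..u} F\<close> by (simp add: set_borel_integral_eq_integral)
  qed
  have "((\<lambda>u. integral {a..u} F) has_vector_derivative F x) (at x within {a..x+1})"
    by (rule integral_has_vector_derivative) (auto simp: a_def intro: continuous_on_subset [OF F])
  then have "((\<lambda>u. integral {a..u} F) has_vector_derivative F x) (at x)"
    using at_within_Icc_at [of a x "x + 1"] by (simp add: a_def)
  then have "((\<lambda>u. (LINT y:{..<a}|lborel. F y) + integral {a..u} F) has_vector_derivative F x) (at x)"
    by (auto intro!: derivative_eq_intros)
  then show ?thesis
    by (rule has_vector_derivative_transform_within_open [of _ _ _ "{a<..}"])
      (auto simp: eq less_imp_le, simp add: a_def)
qed

text \<open>Rests on \<open>(1 + y / n) ^ n \<le> exp y\<close> for \<open>y = \<delta> * s\<close>: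
  expanding \<open>(1 + n / \<delta>) (1 + \<delta> * s / n)\<close> produces both 1 and
  \<open>s\<close>. The constant involves only \<open>n\<close> and \<open>\<delta>\<close>, which
  is the source of uniformity over the modes.\<close>

lemma exp_beats_power:
  fixes \<delta> s :: real
  assumes "\<delta> > 0" "s \<ge> 0"
  shows "(1 + s) ^ n * exp (- (\<delta> * s)) \<le> (1 + n / \<delta>) ^ n"
proof (cases "n = 0")
  case True
  then show ?thesis using assms by simp
next
  case False
  then have n: "n > 0" by simp
  have "1 + s \<le> (1 + n / \<delta>) * (1 + \<delta> * s / n)"
    using assms n by (simp add: field_simps)
  then have "(1 + s) ^ n \<le> ((1 + n / \<delta>) * (1 + \<delta> * s / n)) ^ n"
    using assms by (intro power_mono) auto
  also have "\<dots> = (1 + n / \<delta>) ^ n * (1 + \<delta> * s / n) ^ n" by (rule power_mult_distrib)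
  also have "\<dots> \<le> (1 + n / \<delta>) ^ n * exp (\<delta> * s)"
    using assms n order_trans [of "- real n" 0 "\<delta> * s"]
    by (intro mult_left_mono exp_ge_one_plus_x_over_n_power_n) auto
  finally have "(1 + s) ^ n * exp (- (\<delta> * s)) \<le> (1 + n / \<delta>) ^ n * exp (\<delta> * s) * exp (- (\<delta> * s))"
    by (intro mult_right_mono) auto
  then show ?thesis by (simp add: mult.assoc exp_add [symmetric])
qed

text \<open>The solution decaying at \<open>-\<infinity>\<close>; for \<open>Re l = 0\<close> the compatibility condition
  turns the integral over \<open>{..x}\<close> into minus the integral over \<open>{x<..}\<close>, which is
  what makes it decay at \<open>\<infinity>\<close> as well.\<close>

lemma ode_solution_nonneg:
  fixes \<delta> :: real and l :: complex and G :: "real \<Rightarrow> complex"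
  assumes \<delta>: "\<delta> > 0" and G: "continuous_on UNIV G"
    and G2: "\<And>y. (1 + \<bar>y\<bar>) ^ 2 * norm (G y) \<le> B2"
    and l: "Re l \<ge> \<delta> \<or> Re l = 0 \<and> (LINT y|lborel. exp (l * of_real y) * G y) = 0"
  shows "\<exists>v. (\<forall>x. (v has_vector_derivative G x - l * v x) (at x)) \<and>
     (\<forall>N B x. (\<forall>y. (1 + \<bar>y\<bar>) ^ (N + 2) * norm (G y) \<le> B) \<longrightarrow>
        (1 + \<bar>x\<bar>) ^ N * norm (v x) \<le> (1 + N / \<delta>) ^ N * decay_mass * B)"
proof -
  have Re: "Re l \<ge> 0" using l \<delta> by auto
  have B2: "B2 \<ge> 0" by (rule order_trans [OF _ G2 [of 0]]) simp
  define F where "F y = exp (l * of_real y) * G y" for y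
  have cF: "continuous_on UNIV F" unfolding F_def by (intro continuous_intros G)
  \<comment> \<open>Since \<open>Re l \<ge> 0\<close>, the exponential factor on
    \<open>{..x}\<close> is largest at \<open>x\<close>, so two powers of decay of \<open>G\<close>
    give integrability.\<close>
  have iF: "set_integrable lborel {..x} F" for x
  proof (rule set_integral_decay(1) [OF cF, where D = "exp (Re l * x) * B2"])
    fix y assume y: "y \<in> {..x}"
    have "norm (F y) = exp (Re l * y) * norm (G y)"
      by (simp add: F_def norm_mult)
    also have "\<dots> \<le> exp (Re l * x) * (B2 * (1 / (1 + \<bar>y\<bar>) ^ 2))"
      using y Re G2 [of y] by (intro mult_mono) (auto simp: mult_left_mono mult_right_mono field_simps)
    finally show "norm (F y) \<le> exp (Re l * x) * B2 * (1 / (1 + \<bar>y\<bar>) ^ 2)" by simp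
  qed (use B2 in auto)
  \<comment> \<open>Variation of constants: \<open>F\<close> is the right-hand side times the
    integrating factor.\<close>
  define v where "v x = exp (- l * of_real x) * (LINT y:{..x}|lborel. F y)" for x
  have e: "((\<lambda>x. exp (- l * of_real x)) has_vector_derivative - l * exp (- l * of_real x)) (at x)" for x :: real
    by (rule has_vector_derivative_real_field) (auto intro!: derivative_eq_intros)
  have ode: "(v has_vector_derivative G x - l * v x) (at x)" for x
    unfolding v_def
    by (rule has_vector_derivative_eq_rhs [OF has_vector_derivative_mult [OF e set_integral_atMost_deriv [OF cF iF]]])
      (simp add: F_def [abs_def] mult.assoc [symmetric] exp_add [symmetric])
  have bound: "(1 + \<bar>x\<bar>) ^ N * norm (v x) \<le> (1 + N / \<delta>) ^ N * decay_mass * B"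
    if B: "\<And>y. (1 + \<bar>y\<bar>) ^ (N + 2) * norm (G y) \<le> B" for N B x
  proof -
    define E where "E = (1 + N / \<delta>) ^ N"
    have E: "E \<ge> 1" unfolding E_def using \<delta> by (intro one_le_power) auto
    have "B \<ge> 0" by (rule order_trans [OF _ B [of 0]]) simp
    have cF': "continuous_on UNIV (\<lambda>y. exp (- l * of_real x) * F y)"
      by (intro continuous_intros cF)
    \<comment> \<open>Of the \<open>N + 2\<close> powers of decay of \<open>G\<close>, the kernel
      inequality \<open>h\<close> transfers \<open>N\<close> from \<open>y\<close> to
      \<open>x\<close>, and two remain for integration.\<close>
    have key: "norm (exp (- l * of_real x) * F y) \<le> (E * B / (1 + \<bar>x\<bar>) ^ N) * (1 / (1 + \<bar>y\<bar>) ^ 2)"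
      if h: "(1 + \<bar>x\<bar>) ^ N * exp (Re l * (y - x)) \<le> E * (1 + \<bar>y\<bar>) ^ N" for y
    proof -
      have "norm (exp (- l * of_real x) * F y) = exp (Re l * (y - x)) * norm (G y)"
      proof -
        have "exp (Re l * (y - x)) = exp (- (Re l * x)) * exp (Re l * y)"
          by (simp add: exp_add [symmetric] algebra_simps)
        then show ?thesis by (simp add: F_def norm_mult)
      qed
      then have "(1 + \<bar>x\<bar>) ^ N * (1 + \<bar>y\<bar>) ^ 2 * norm (exp (- l * of_real x) * F y)
         = ((1 + \<bar>x\<bar>) ^ N * exp (Re l * (y - x))) * ((1 + \<bar>y\<bar>) ^ 2 * norm (G y))"
        by simp
      also have "\<dots> \<le> (E * (1 + \<bar>y\<bar>) ^ N) * ((1 + \<bar>y\<bar>) ^ 2 * norm (G y))"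
        by (intro mult_right_mono h) auto
      also have "\<dots> = E * ((1 + \<bar>y\<bar>) ^ (N + 2) * norm (G y))"
        by (simp add: power_add power2_eq_square mult_ac)
      also have "\<dots> \<le> E * B" using E by (intro mult_left_mono B) auto
      finally show ?thesis by (simp add: pos_le_divide_eq mult_ac)
    qed
    \<comment> \<open>The left integral fails to show decay only if \<open>Re l = 0\<close> and
      \<open>x > 0\<close>: the kernel has modulus 1 there, and \<open>{..x}\<close> contains points
      \<open>y\<close> near 0.\<close>
    have "norm (v x) \<le> (E * B / (1 + \<bar>x\<bar>) ^ N) * decay_mass"
    proof (cases "Re l \<ge> \<delta> \<or> x \<le> 0")
      case True
      have "v x = (LINT y:{..x}|lborel. exp (- l * of_real x) * F y)"
        unfolding v_def by simp
      also have "norm \<dots> \<le> (E * B / (1 + \<bar>x\<bar>) ^ N) * decay_mass"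
      proof (rule set_integral_decay(2) [OF cF'])
        fix y assume y: "y \<in> {..x}"
        show "norm (exp (- l * of_real x) * F y) \<le> (E * B / (1 + \<bar>x\<bar>) ^ N) * (1 / (1 + \<bar>y\<bar>) ^ 2)"
        proof (rule key)
          show "(1 + \<bar>x\<bar>) ^ N * exp (Re l * (y - x)) \<le> E * (1 + \<bar>y\<bar>) ^ N"
          proof (cases "Re l \<ge> \<delta>")
            case True
            define s where "s = x - y"
            have s: "s \<ge> 0" "x = y + s" using y by (auto simp: s_def)
            \<comment> \<open>The weight is submultiplicative; moving it from \<open>x\<close> to
              \<open>y\<close> costs powers of the distance \<open>s\<close>, which the exponential
              absorbs.\<close>
            have "1 + \<bar>x\<bar> \<le> (1 + \<bar>y\<bar>) * (1 + s)"
            proof -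
              have "0 \<le> \<bar>y\<bar> * s" using s by simp
              moreover have "(1 + \<bar>y\<bar>) * (1 + s) = 1 + \<bar>y\<bar> + s + \<bar>y\<bar> * s" by (simp add: algebra_simps)
              ultimately show ?thesis using s by linarith
            qed
            then have "(1 + \<bar>x\<bar>) ^ N \<le> (1 + \<bar>y\<bar>) ^ N * (1 + s) ^ N"
              unfolding power_mult_distrib [symmetric] by (intro power_mono) auto
            moreover have "exp (Re l * (y - x)) \<le> exp (- (\<delta> * s))"
            proof -
              have "\<delta> * s \<le> Re l * s" using True s by (intro mult_right_mono)
              moreover have "Re l * (y - x) = - (Re l * s)" by (simp add: s_def algebra_simps)
              ultimately show ?thesis by simp
            qed
            ultimately have "(1 + \<bar>x\<bar>) ^ N * exp (Re l * (y - x)) \<le> ((1 + \<bar>y\<bar>) ^ N * (1 + s) ^ N) * exp (- (\<delta> * s))"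
              using s by (intro mult_mono) auto
            also have "\<dots> = (1 + \<bar>y\<bar>) ^ N * ((1 + s) ^ N * exp (- (\<delta> * s)))" by simp
            also have "\<dots> \<le> (1 + \<bar>y\<bar>) ^ N * E"
              unfolding E_def by (intro mult_left_mono exp_beats_power \<delta> s) auto
            finally show ?thesis by (simp add: mult.commute)
          next
            case False
            then have "x \<le> 0" using \<open>Re l \<ge> \<delta> \<or> x \<le> 0\<close> by simp
            then have "(1 + \<bar>x\<bar>) ^ N \<le> (1 + \<bar>y\<bar>) ^ N" using y by (intro power_mono) auto
            moreover have "exp (Re l * (y - x)) \<le> 1"
              using Re y by (simp add: mult_nonneg_nonpos)
            ultimately have "(1 + \<bar>x\<bar>) ^ N * exp (Re l * (y - x)) \<le> (1 + \<bar>y\<bar>) ^ N * 1"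
              by (intro mult_mono) auto
            also have "\<dots> \<le> E * (1 + \<bar>y\<bar>) ^ N" using E by simp
            finally show ?thesis .
          qed
        qed
      qed (use E \<open>B \<ge> 0\<close> in auto)
      finally show ?thesis .
    next
      case False
      then have x: "x > 0" and l0: "Re l = 0" and z: "(LINT y|lborel. F y) = 0"
        using l by (auto simp: F_def)
      have iU: "set_integrable lborel UNIV F"
      proof (rule set_integral_decay(1) [OF cF _ B2])
        fix y show "norm (F y) \<le> B2 * (1 / (1 + \<bar>y\<bar>) ^ 2)"
          using G2 [of y] by (simp add: F_def norm_mult l0 field_simps)
      qed auto
      have "0 = (LINT y:{..x} \<union> {x<..}|lborel. F y)"
      proof -
        have "{..x} \<union> {x<..} = UNIV" by auto
        then show ?thesis using z by (simp add: set_lebesgue_integral_def)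
      qed
      also have "\<dots> = (LINT y:{..x}|lborel. F y) + (LINT y:{x<..}|lborel. F y)"
        by (intro set_integral_Un set_integrable_subset [OF iU]) auto
      finally have "(LINT y:{..x}|lborel. F y) = - (LINT y:{x<..}|lborel. F y)"
        by (simp add: eq_neg_iff_add_eq_0)
      then have "v x = - (LINT y:{x<..}|lborel. exp (- l * of_real x) * F y)"
        unfolding v_def by simp
      then have "norm (v x) = norm (LINT y:{x<..}|lborel. exp (- l * of_real x) * F y)" by simp
      also have "\<dots> \<le> (E * B / (1 + \<bar>x\<bar>) ^ N) * decay_mass"
      proof (rule set_integral_decay(2) [OF cF'])
        fix y assume y: "y \<in> {x<..}"
        show "norm (exp (- l * of_real x) * F y) \<le> (E * B / (1 + \<bar>x\<bar>) ^ N) * (1 / (1 + \<bar>y\<bar>) ^ 2)"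
        proof (rule key)
          have "(1 + \<bar>x\<bar>) ^ N \<le> 1 * (1 + \<bar>y\<bar>) ^ N" using y x by (simp add: power_mono)
          also have "\<dots> \<le> E * (1 + \<bar>y\<bar>) ^ N" using E by (intro mult_right_mono) auto
          finally show "(1 + \<bar>x\<bar>) ^ N * exp (Re l * (y - x)) \<le> E * (1 + \<bar>y\<bar>) ^ N" by (simp add: l0)
        qed
      qed (use E \<open>B \<ge> 0\<close> in auto)
      finally show ?thesis .
    qed
    then have "(1 + \<bar>x\<bar>) ^ N * norm (v x) \<le> (1 + \<bar>x\<bar>) ^ N * ((E * B / (1 + \<bar>x\<bar>) ^ N) * decay_mass)"
      by (intro mult_left_mono) auto
    also have "\<dots> = E * decay_mass * B"
    proof -
      have "(1 + \<bar>x\<bar>) ^ N \<noteq> 0" by simp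
      then show ?thesis by (simp del: power_eq_0_iff)
    qed
    finally show ?thesis by (simp add: E_def)
  qed
  show ?thesis using ode bound by blast
qed

text \<open>The reflection of \<open>x\<close> replaces \<open>l\<close> by \<open>- l\<close> and
  reduces negative \<open>Re l\<close> to the previous lemma. As \<open>v\<close> is chosen before
  \<open>N\<close> and \<open>B\<close>, one solution has all decay rates, with constants that
  depend on \<open>l\<close> only through \<open>\<delta>\<close>.\<close>

lemma ode_solution:
  fixes \<delta> :: real and l :: complex and G :: "real \<Rightarrow> complex"
  assumes \<delta>: "\<delta> > 0" and G: "continuous_on UNIV G"
    and G2: "\<And>y. (1 + \<bar>y\<bar>) ^ 2 * norm (G y) \<le> B2"
    and l: "\<bar>Re l\<bar> \<ge> \<delta> \<or> Re l = 0 \<and> (LINT y|lborel. exp (l * of_real y) * G y) = 0"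
  shows "\<exists>v. (\<forall>x. (v has_vector_derivative G x - l * v x) (at x)) \<and>
     (\<forall>N B x. (\<forall>y. (1 + \<bar>y\<bar>) ^ (N + 2) * norm (G y) \<le> B) \<longrightarrow>
        (1 + \<bar>x\<bar>) ^ N * norm (v x) \<le> (1 + N / \<delta>) ^ N * decay_mass * B)"
proof (cases "Re l \<ge> \<delta> \<or> Re l = 0")
  case True
  then show ?thesis using l \<delta> by (intro ode_solution_nonneg [OF \<delta> G G2]) auto
next
  case False
  then have l': "Re (- l) \<ge> \<delta>" using l by auto
  define H where "H y = - G (- y)" for y
  have "continuous_on UNIV H"
    unfolding H_def by (intro continuous_intros continuous_on_compose2 [OF G]) auto
  moreover have "(1 + \<bar>y\<bar>) ^ 2 * norm (H y) \<le> B2" for y using G2 [of "- y"] by (simp add: H_def)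
  ultimately obtain w where w: "\<And>x. (w has_vector_derivative H x - (- l) * w x) (at x)"
    and b: "\<And>N B x. (\<forall>y. (1 + \<bar>y\<bar>) ^ (N + 2) * norm (H y) \<le> B) \<Longrightarrow>
        (1 + \<bar>x\<bar>) ^ N * norm (w x) \<le> (1 + N / \<delta>) ^ N * decay_mass * B"
    using ode_solution_nonneg [OF \<delta>, of H B2 "- l"] l' by blast
  show ?thesis
  proof (intro exI [of _ "\<lambda>x. w (- x)"] conjI allI impI)
    fix x
    have "(w \<circ> uminus has_vector_derivative (- 1) *\<^sub>R (H (- x) - (- l) * w (- x))) (at x)"
      by (rule vector_diff_chain_at [OF _ w]) (auto intro!: derivative_eq_intros)
    then show "((\<lambda>x. w (- x)) has_vector_derivative G x - l * w (- x)) (at x)"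
      by (simp add: H_def o_def)
  next
    fix N :: nat and B x
    assume B: "\<forall>y. (1 + \<bar>y\<bar>) ^ (N + 2) * norm (G y) \<le> B"
    have "(1 + \<bar>y\<bar>) ^ (N + 2) * norm (H y) \<le> B" for y
      using B [rule_format, of "- y"] by (simp add: H_def)
    then show "(1 + \<bar>x\<bar>) ^ N * norm (w (- x)) \<le> (1 + N / \<delta>) ^ N * decay_mass * B"
      using b [of N B "- x"] by simp
  qed
qed

section \<open>The Fourier transform on the line\<close>

text \<open>The set where \<open>g\<close> is nonzero is open and null, and a nonempty open set is
  not null.\<close>

lemma AE_zero_continuous:
  fixes g :: "real \<Rightarrow> real"
  assumes g: "continuous_on UNIV g" and z: "AE x in lborel. g x = 0"
  shows "g x = 0"
proof (rule ccontr)
  assume "g x \<noteq> 0"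
  have "open {x. g x \<noteq> 0}"
    using open_Collect_neq [OF g continuous_on_const [of UNIV 0]] by simp
  moreover have "{x. g x \<noteq> 0} \<in> null_sets lborel"
    using z AE_iff_null [of lborel "\<lambda>x. g x = 0"] borel_open [OF calculation] by simp
  then have "negligible {x. g x \<noteq> 0}"
    by (simp add: negligible_iff_null_sets null_sets_completionI)
  ultimately show False using open_not_negligible \<open>g x \<noteq> 0\<close> by blast
qed

lemma real_distribution_density:
  fixes p :: "real \<Rightarrow> real"
  assumes i: "integrable lborel p" and p: "\<And>x. 0 \<le> p x" and m: "(LINT x|lborel. p x) = 1"
  shows "real_distribution (density lborel p)"
    and "char (density lborel p) t = (LINT x|lborel. of_real (p x) * exp (\<i> * of_real (t * x)))"
proof -
  have [measurable]: "p \<in> borel_measurable borel" using i by auto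
  have "emeasure (density lborel p) UNIV = 1"
    using nn_integral_eq_integral [OF i] p m by (simp add: emeasure_density)
  then show "real_distribution (density lborel p)"
    unfolding real_distribution_def real_distribution_axioms_def by (auto intro!: prob_spaceI)
  show "char (density lborel p) t = (LINT x|lborel. of_real (p x) * exp (\<i> * of_real (t * x)))"
    unfolding char_def by (subst integral_density) (auto simp: p scaleR_conv_of_real)
qed

text \<open>The positive and negative parts of \<open>g\<close> have the same transform, hence at
  frequency 0 the same mass. Scaled to probability densities they have the same characteristic
  function, so Levy's theorem identifies them almost everywhere, and continuity does the
  rest.\<close>

lemma Fourier_injective_real:
  fixes g :: "real \<Rightarrow> real"
  assumes g: "continuous_on UNIV g" and i: "integrable lborel g"
    and z: "\<And>t. (LINT x|lborel. of_real (g x) * exp (\<i> * of_real (t * x))) = 0"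
  shows "g x = 0"
proof -
  define p where "p x = max 0 (g x)" for x
  define n where "n x = max 0 (- g x)" for x
  have g_eq: "g x = p x - n x" for x by (auto simp: p_def n_def max_def)
  have ip: "integrable lborel p" and "in": "integrable lborel n"
    unfolding p_def n_def using i by (auto intro!: integrable_max)
  have nonneg: "p x \<ge> 0" "n x \<ge> 0" for x by (auto simp: p_def n_def)
  have e: "integrable lborel (\<lambda>x. complex_of_real (q x) * exp (\<i> * of_real (t * x)))" if q: "integrable lborel q" for q t
  proof (rule Bochner_Integration.integrable_bound [OF q])
    show "(\<lambda>x. complex_of_real (q x) * exp (\<i> * of_real (t * x))) \<in> borel_measurable lborel"
      using q by (intro borel_measurable_times borel_measurable_continuous_onI continuous_intros) auto
  qed (simp add: norm_mult)
  have eq: "(LINT x|lborel. of_real (p x) * exp (\<i> * of_real (t * x))) = (LINT x|lborel. of_real (n x) * exp (\<i> * of_real (t * x)))" for t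
  proof -
    have "(LINT x|lborel. of_real (p x) * exp (\<i> * of_real (t * x))) - (LINT x|lborel. of_real (n x) * exp (\<i> * of_real (t * x)))
      = (LINT x|lborel. of_real (g x) * exp (\<i> * of_real (t * x)))"
      unfolding g_eq by (subst Bochner_Integration.integral_diff [symmetric]) (rule e [OF ip], rule e [OF "in"], simp add: left_diff_distrib)
    then show ?thesis using z by simp
  qed
  define m where "m = (LINT x|lborel. p x)"
  have mn: "m = (LINT x|lborel. n x)" using eq [of 0] by (simp add: m_def)
  have "m \<ge> 0" unfolding m_def using nonneg by (intro integral_nonneg_AE) auto
  have "AE x in lborel. p x = n x"
  \<comment> \<open>Normalisation divides by \<open>m\<close>; if \<open>m = 0\<close>, both parts
    are nonnegative with integral zero and vanish almost everywhere.\<close>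
  proof (cases "m = 0")
    case True
    then have "AE x in lborel. p x = 0" "AE x in lborel. n x = 0"
      using integral_nonneg_eq_0_iff_AE [OF ip] integral_nonneg_eq_0_iff_AE [OF "in"] nonneg mn
      by (auto simp: m_def)
    then show ?thesis by eventually_elim simp
  next
    case False
    with \<open>m \<ge> 0\<close> have m: "m > 0" by simp
    have P: "integrable lborel (\<lambda>x. p x / m)" "\<And>x. 0 \<le> p x / m" "(LINT x|lborel. p x / m) = 1"
      using ip nonneg m by (auto simp: m_def)
    have N: "integrable lborel (\<lambda>x. n x / m)" "\<And>x. 0 \<le> n x / m" "(LINT x|lborel. n x / m) = 1"
      using "in" nonneg m by (auto simp: mn)
    have "char (density lborel (\<lambda>x. p x / m)) = char (density lborel (\<lambda>x. n x / m))"
    proof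
      fix t
      have "(LINT x|lborel. of_real (p x / m) * exp (\<i> * of_real (t * x))) = (LINT x|lborel. of_real (n x / m) * exp (\<i> * of_real (t * x)))"
        using eq [of t] by (simp add: divide_inverse mult.commute [of _ "inverse (complex_of_real m)"] mult.assoc)
      then show "char (density lborel (\<lambda>x. p x / m)) t = char (density lborel (\<lambda>x. n x / m)) t"
        by (simp only: real_distribution_density(2) [OF P] real_distribution_density(2) [OF N])
    qed
    then have "density lborel (\<lambda>x. p x / m) = density lborel (\<lambda>x. n x / m)"
      by (rule Levy_uniqueness [OF real_distribution_density(1) [OF P] real_distribution_density(1) [OF N]])
    then have "AE x in lborel. ennreal (p x / m) = ennreal (n x / m)"
      using P(1) N(1) by (subst (asm) sigma_finite_measure.density_unique_iff [OF sigma_finite_lborel]) auto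
    then show ?thesis
      by eventually_elim (use nonneg m in \<open>auto simp: divide_nonneg_pos\<close>)
  qed
  then have "AE x in lborel. g x = 0" by eventually_elim (simp add: g_eq)
  then show ?thesis by (rule AE_zero_continuous [OF g])
qed

text \<open>Conjugating the transform at \<open>- t\<close> gives the transform of
  \<open>cnj g\<close> at \<open>t\<close>, so the transform of \<open>Re g\<close> vanishes too.
  The imaginary part is the real part of \<open>- \<i> * g\<close>.\<close>

lemma Fourier_injective:
  fixes g :: "real \<Rightarrow> complex"
  assumes g: "continuous_on UNIV g" and i: "integrable lborel g"
    and z: "\<And>t. (LINT x|lborel. g x * exp (\<i> * of_real (t * x))) = 0"
  shows "g x = 0"
proof -
  have Re0: "Re (g x) = 0" if g: "continuous_on UNIV g" and i: "integrable lborel g"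
    and z: "\<And>t. (LINT x|lborel. g x * exp (\<i> * of_real (t * x))) = 0" for g :: "real \<Rightarrow> complex" and x
  proof (rule Fourier_injective_real [where g = "\<lambda>x. Re (g x)"])
    show "continuous_on UNIV (\<lambda>x. Re (g x))" by (intro continuous_intros g)
    show "integrable lborel (\<lambda>x. Re (g x))" using i by simp
    fix t
    have e: "integrable lborel (\<lambda>x. g x * exp (\<i> * of_real (t * x)))" for t
      by (rule Bochner_Integration.integrable_bound [OF i])
        (use i in \<open>auto simp: norm_mult intro!: borel_measurable_times borel_measurable_continuous_onI continuous_intros\<close>)
    have "(LINT x|lborel. cnj (g x * exp (\<i> * of_real ((- t) * x)))) = 0"
      using Bochner_Integration.integral_cnj [of lborel "\<lambda>x. g x * exp (\<i> * of_real ((- t) * x))"]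
      by (simp only: z complex_cnj_zero)
    then have "(LINT x|lborel. g x * exp (\<i> * of_real (t * x)) + cnj (g x * exp (\<i> * of_real ((- t) * x)))) = 0"
      using z [of t]
      by (subst Bochner_Integration.integral_add) (rule e, rule integrable_cnj, rule e, simp)
    also have "(\<lambda>x. g x * exp (\<i> * of_real (t * x)) + cnj (g x * exp (\<i> * of_real ((- t) * x))))
        = (\<lambda>x. 2 * (of_real (Re (g x)) * exp (\<i> * of_real (t * x))))"
    proof
      fix x
      have "cnj (exp (\<i> * of_real ((- t) * x))) = exp (\<i> * of_real (t * x))"
        by (simp add: exp_cnj)
      moreover have "g x + cnj (g x) = 2 * of_real (Re (g x))"
        by (simp add: complex_add_cnj)
      ultimately show "g x * exp (\<i> * of_real (t * x)) + cnj (g x * exp (\<i> * of_real ((- t) * x)))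
          = 2 * (of_real (Re (g x)) * exp (\<i> * of_real (t * x)))"
        by (simp only: complex_cnj_mult distrib_right [symmetric] mult.assoc [symmetric])
    qed
    finally show "(LINT x|lborel. of_real (Re (g x)) * exp (\<i> * of_real (t * x))) = 0" by simp
  qed
  have "Re (- \<i> * g x) = 0"
  proof (rule Re0)
    show "(LINT x|lborel. (- \<i> * g x) * exp (\<i> * of_real (t * x))) = 0" for t
      using z [of t] by (simp add: mult.assoc)
  qed (use g i in \<open>auto intro!: continuous_intros\<close>)
  then show ?thesis using Re0 [OF g i z] by (simp add: complex_eq_iff)
qed

text \<open>By Fubini the \<open>t\<close>-integral may be done before the
  \<open>x\<close>-integral, which turns the hypothesis on the mixed transform into one on each
  single coefficient.\<close>

lemma mixed_ft_fcoef:
  assumes f: "f \<in> schwartz_TR"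
  shows "mixed_ft f k \<xi> = (LINT x|lborel. fcoef f k 0 x * exp (\<i> * of_real ((- \<xi>) * x)))"
proof -
  have sf: "smooth2 f" and bd: "\<And>c. \<exists>C. \<forall>t x. norm (of_real (x ^ c) * pd (replicate 0 True @ replicate 0 False) f (t, x)) \<le> C"
    using f unfolding schwartz_TR_def by blast+
  have cf: "continuous_on UNIV f" using smooth2_pd_continuous [OF sf, of UNIV "[]"] by simp
  obtain C0 C2 where C: "\<And>t x. norm (of_real (x ^ 0) * f (t, x)) \<le> C0" "\<And>t x. norm (of_real (x ^ 2) * f (t, x)) \<le> C2"
    using bd [of 0] bd [of 2] by auto
  define C where "C = 4 * (C0 + C2)"
  have le: "norm (f (t, x)) \<le> C * (1 / (1 + \<bar>x\<bar>) ^ 2)" for t x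
  proof -
    have "(1 + \<bar>x\<bar>) ^ 2 * norm (f (t, x)) \<le> (2 ^ 2 * (1 + \<bar>x\<bar> ^ 2)) * norm (f (t, x))"
      by (intro mult_right_mono one_plus_power_le) auto
    also have "\<dots> = 4 * (norm (of_real (x ^ 0) * f (t, x)) + norm (of_real (x ^ 2) * f (t, x)))"
      by (simp add: norm_mult norm_power algebra_simps)
    also have "\<dots> \<le> C" unfolding C_def by (intro mult_left_mono add_mono C) auto
    finally show ?thesis by (simp add: pos_le_divide_eq mult.commute)
  qed
  have "C \<ge> 0" using order_trans [OF norm_ge_zero le [of 0 0]] by simp
  define h where "h t x = indicator {0..2*pi} t *\<^sub>R (f (t, x) * exp (- \<i> * of_real (of_int k * t + x * \<xi>)))" for t x :: real
  \<comment> \<open>The Fubini majorant: constant in \<open>t\<close> on one period, and integrable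
    in \<open>x\<close> by quadratic decay.\<close>
  define w where "w = (\<lambda>(t, x). indicator {0..2*pi} t * (C * (1 / (1 + \<bar>x\<bar>) ^ 2)) :: real)"
  have iw: "integrable (lborel \<Otimes>\<^sub>M lborel) w"
  proof (rule lborel_pair.Fubini_integrable)
    show "w \<in> borel_measurable (lborel \<Otimes>\<^sub>M lborel)" unfolding w_def by measurable
    have "(\<lambda>t. LINT x|lborel. norm (w (t, x))) = (\<lambda>t. indicator {0..2*pi} t * (C * decay_mass))"
      using \<open>C \<ge> 0\<close> by (auto simp: w_def abs_mult decay_mass_def simp del: times_divide_eq_right)
    then show "integrable lborel (\<lambda>t. LINT x|lborel. norm (w (t, x)))" by simp
    show "AE t in lborel. integrable lborel (\<lambda>x. w (t, x))"
      unfolding w_def prod.case by (intro AE_I2 integrable_mult_right integrable_decay)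
  qed
  have ih: "integrable (lborel \<Otimes>\<^sub>M lborel) (case_prod h)"
  proof (rule Bochner_Integration.integrable_bound [OF iw])
    have "(\<lambda>p. f p * exp (- \<i> * of_real (of_int k * fst p + snd p * \<xi>))) \<in> borel_measurable borel"
      by (intro borel_measurable_continuous_onI continuous_intros cf)
    then have m: "(\<lambda>p. f p * exp (- \<i> * of_real (of_int k * fst p + snd p * \<xi>))) \<in> borel_measurable (lborel \<Otimes>\<^sub>M lborel)"
      by (simp add: lborel_prod)
    have eq: "case_prod h = (\<lambda>p. indicator {0..2*pi} (fst p) *\<^sub>R (f p * exp (- \<i> * of_real (of_int k * fst p + snd p * \<xi>))))"
      by (auto simp: h_def)
    show "case_prod h \<in> borel_measurable (lborel \<Otimes>\<^sub>M lborel)"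
      unfolding eq by (rule borel_measurable_scaleR [OF _ m]) measurable
    show "AE p in lborel \<Otimes>\<^sub>M lborel. norm (case_prod h p) \<le> norm (w p)"
      using le \<open>C \<ge> 0\<close> by (intro AE_I2) (auto simp: h_def w_def norm_mult indicator_def split_beta)
  qed
  have "mixed_ft f k \<xi> = (1 / (2 * of_real pi)) * (LINT t|lborel. LINT x|lborel. h t x)"
    unfolding mixed_ft_def set_lebesgue_integral_def h_def by simp
  also have "(LINT t|lborel. LINT x|lborel. h t x) = (LINT x|lborel. LINT t|lborel. h t x)"
    by (rule lborel_pair.Fubini_integral [OF ih, symmetric])
  also have "\<dots> = (LINT x|lborel. 2 * of_real pi * (fcoef f k 0 x * exp (\<i> * of_real ((- \<xi>) * x))))"
  proof (rule Bochner_Integration.integral_cong [OF refl])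
    fix x
    have c: "continuous_on S (\<lambda>t. emode (- k) t * f (t, x))" for S
      by (intro continuous_intros continuous_on_compose2 [OF cf]) auto
    have "(LINT t|lborel. h t x) = (LINT t:{0..2*pi}|lborel. (emode (- k) t * f (t, x)) * exp (\<i> * of_real ((- \<xi>) * x)))"
      unfolding h_def set_lebesgue_integral_def
    proof (rule Bochner_Integration.integral_cong [OF refl])
      fix t
      have "exp (- \<i> * of_real (of_int k * t + x * \<xi>)) = emode (- k) t * exp (\<i> * of_real ((- \<xi>) * x))"
        unfolding emode_def exp_add [symmetric] by (simp add: algebra_simps)
      then show "indicator {0..2*pi} t *\<^sub>R (f (t, x) * exp (- \<i> * of_real (of_int k * t + x * \<xi>))) =
          indicator {0..2*pi} t *\<^sub>R ((emode (- k) t * f (t, x)) * exp (\<i> * of_real ((- \<xi>) * x)))"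
        by (simp only: mult_ac)
    qed
    also have "\<dots> = integral {0..2*pi} (\<lambda>t. emode (- k) t * f (t, x)) * exp (\<i> * of_real ((- \<xi>) * x))"
      by (simp add: set_borel_integral_eq_integral(2) [OF borel_integrable_atLeastAtMost' [OF c]])
    finally show "(LINT t|lborel. h t x) = 2 * of_real pi * (fcoef f k 0 x * exp (\<i> * of_real ((- \<xi>) * x)))"
      by (simp add: fcoef_def mcoef_def)
  qed
  finally show ?thesis by simp
qed

section \<open>Global solvability\<close>

text \<open>For \<open>a \<noteq> 0\<close> only finitely many integers give modulus below 1, so the
  nonzero values among these have a positive minimum.\<close>

lemma affine_int_gap:
  fixes a b :: complex
  shows "\<exists>\<delta>>0. \<forall>k::int. a * of_int k + b = 0 \<or> \<delta> \<le> norm (a * of_int k + b)"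
proof (cases "a = 0")
  case True
  then show ?thesis by (intro exI [of _ "if b = 0 then 1 else norm b"]) auto
next
  case False
  define K where "K = {k::int. norm (a * of_int k + b) < 1}"
  define N where "N = \<lceil>(1 + norm b) / norm a\<rceil>"
  have "K \<subseteq> {- N..N}"
  proof
    fix k assume "k \<in> K"
    have "norm a * \<bar>of_int k\<bar> = norm ((a * of_int k + b) - b)" by (simp add: norm_mult)
    also have "\<dots> \<le> norm (a * of_int k + b) + norm b" by (rule norm_triangle_ineq4)
    also have "\<dots> \<le> 1 + norm b" using \<open>k \<in> K\<close> by (simp add: K_def)
    finally have "\<bar>real_of_int k\<bar> \<le> (1 + norm b) / norm a" using False by (simp add: field_simps)
    also have "\<dots> \<le> of_int N" unfolding N_def by (rule le_of_int_ceiling)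
    finally have "\<bar>k\<bar> \<le> N" by (simp add: of_int_abs [symmetric] del: of_int_abs)
    then show "k \<in> {- N..N}" by auto
  qed
  then have fin: "finite K" by (rule finite_subset) simp
  \<comment> \<open>Inserting 1 keeps the set nonempty and makes its minimum a lower bound outside
    \<open>K\<close> as well.\<close>
  define D where "D = insert 1 ((\<lambda>k. norm (a * of_int k + b)) ` {k \<in> K. a * of_int k + b \<noteq> 0})"
  have D: "finite D" "D \<noteq> {}" using fin by (auto simp: D_def)
  have "Min D > 0" using D by (simp add: D_def)
  moreover have "a * of_int k + b = 0 \<or> Min D \<le> norm (a * of_int k + b)" for k
  proof (cases "k \<in> K")
    case True
    then have "norm (a * of_int k + b) \<in> D" if "a * of_int k + b \<noteq> 0"
      using that by (simp add: D_def)
    then show ?thesis using Min_le [OF D(1)] by blast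
  next
    case False
    then have "1 \<le> norm (a * of_int k + b)" by (simp add: K_def)
    moreover have "Min D \<le> 1" using D by (simp add: D_def)
    ultimately show ?thesis by simp
  qed
  ultimately show ?thesis by blast
qed

text \<open>The derivatives of a solution \<open>w\<close> of \<open>c w' + m w = g 0\<close>, where \<open>g b\<close> is the \<open>b\<close>-th
  derivative of \<open>g 0\<close>.\<close>

primrec ode_jet :: "complex \<Rightarrow> complex \<Rightarrow> (nat \<Rightarrow> real \<Rightarrow> complex) \<Rightarrow> (real \<Rightarrow> complex) \<Rightarrow> nat \<Rightarrow> real \<Rightarrow> complex" where
  "ode_jet c m g w 0 = w"
| "ode_jet c m g w (Suc b) = (\<lambda>x. (g b x - m * ode_jet c m g w b x) / c)"

text \<open>The equation expresses each derivative of \<open>w k\<close> through the previous one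
  times \<open>m k\<close>, at the cost of one power of \<open>1 + |k|\<close>. Hence only the decay
  of \<open>w k\<close> itself is assumed, and the induction on \<open>b\<close> keeps
  \<open>a\<close> arbitrary.\<close>

lemma rapid_ode_jet:
  assumes g: "rapid g" and c: "c \<noteq> 0"
    and w: "\<And>k x. (w k has_vector_derivative (g k 0 x - m k * w k x) / c) (at x)"
    and m: "\<And>k. norm (m k) \<le> A * (1 + \<bar>of_int k\<bar>)"
    and bd: "\<And>a n. \<exists>C. \<forall>k x. (1 + \<bar>of_int k\<bar>) ^ a * (1 + \<bar>x\<bar>) ^ n * norm (w k x) \<le> C"
  shows "rapid (\<lambda>k. ode_jet c (m k) (g k) (w k))" (is "rapid ?v")
proof (rule rapidI)
  show "(?v k b has_vector_derivative ?v k (Suc b) x) (at x)" for k b x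
  proof (induction b arbitrary: x)
    case 0
    then show ?case using w by simp
  next
    case (Suc b)
    have "((\<lambda>x. inverse c * (g k b x - m k * ?v k b x)) has_vector_derivative inverse c * (g k (Suc b) x - m k * ?v k (Suc b) x)) (at x)"
      by (intro has_vector_derivative_mult_right has_vector_derivative_diff rapid_deriv [OF g] Suc.IH)
    then show ?case by (simp add: divide_inverse mult.commute)
  qed
  show "\<exists>C. \<forall>k x. (1 + \<bar>of_int k\<bar>) ^ a * (1 + \<bar>x\<bar>) ^ n * norm (?v k b x) \<le> C" for a b n
  proof (induction b arbitrary: a)
    case 0
    then show ?case using bd by simp
  next
    case (Suc b)
    obtain C where C: "\<And>k x. (1 + \<bar>of_int k\<bar>) ^ a * (1 + \<bar>x\<bar>) ^ n * norm (g k b x) \<le> C"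
      using rapid_bound [OF g] by metis
    obtain D where D: "\<And>k x. (1 + \<bar>of_int k\<bar>) ^ Suc a * (1 + \<bar>x\<bar>) ^ n * norm (?v k b x) \<le> D"
      using Suc.IH by metis
    have "0 \<le> A" using order_trans [OF norm_ge_zero m [of 0]] by simp
    have "(1 + \<bar>of_int k\<bar>) ^ a * (1 + \<bar>x\<bar>) ^ n * norm (?v k (Suc b) x) \<le> (C + A * D) / norm c" for k x
    proof -
      let ?W = "(1 + \<bar>of_int k\<bar>) ^ a * (1 + \<bar>x\<bar>) ^ n :: real"
      have "norm (g k b x - m k * ?v k b x) \<le> norm (g k b x) + (A * (1 + \<bar>of_int k\<bar>)) * norm (?v k b x)"
        by (rule order_trans [OF norm_triangle_ineq4]) (auto simp: norm_mult intro: mult_right_mono m)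
      then have "?W * norm (g k b x - m k * ?v k b x) \<le> ?W * (norm (g k b x) + (A * (1 + \<bar>of_int k\<bar>)) * norm (?v k b x))"
        by (intro mult_left_mono) auto
      also have "\<dots> = ?W * norm (g k b x) + A * ((1 + \<bar>of_int k\<bar>) ^ Suc a * (1 + \<bar>x\<bar>) ^ n * norm (?v k b x))"
        by (simp add: algebra_simps)
      also have "\<dots> \<le> C + A * D" by (intro add_mono mult_left_mono C D \<open>0 \<le> A\<close>)
      finally show ?thesis using c by (simp add: norm_divide divide_right_mono)
    qed
    then show ?case by blast
  qed
qed

text \<open>Reduces solvability to finding a rapid family that solves the equation of every mode;
  \<open>fser\<close> sees only the entries \<open>b = 0\<close>, so agreement there
  suffices.\<close>

lemma Lop_fser_eq:
  assumes f: "f \<in> schwartz_TR" and v: "rapid v"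
    and eq: "\<And>k x. (\<i> * c1 * of_int k + c3) * v k 0 x + c2 * v k (Suc 0) x = fcoef f k 0 x"
  shows "\<exists>u \<in> schwartz_TR. Lop c1 c2 c3 u = f"
proof
  have "Lop c1 c2 c3 (fser v) = fser (fcoef f)"
    unfolding Lop_fser [OF v] by (simp add: fser_def eq)
  then show "Lop c1 c2 c3 (fser v) = f" by (simp add: fser_fcoef [OF f])
qed (rule fser_schwartz [OF v])

theorem theorem4p2:
  fixes c1 c2 c3 :: complex and f :: "real \<times> real \<Rightarrow> complex"
  assumes "c1 \<noteq> 0 \<or> c2 \<noteq> 0"
    and "f \<in> schwartz_TR"
    and "\<forall>(k::int) (\<xi>::real). symb c1 c2 c3 k \<xi> = 0 \<longrightarrow> mixed_ft f k \<xi> = 0"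
  shows "\<exists>u \<in> schwartz_TR. Lop c1 c2 c3 u = f"
proof -
  note f = assms(2)
  define g where "g = fcoef f"
  define m where "m k = \<i> * c1 * of_int k + c3" for k :: int
  have g: "rapid g" unfolding g_def by (rule rapid_fcoef [OF f])
  have cg: "continuous_on UNIV (g k b)" for k b by (rule rapid_continuous [OF g])
  have zero: "(LINT x|lborel. g k 0 x * exp (\<i> * of_real ((- \<xi>) * x))) = 0" if "m k + \<i> * c2 * of_real \<xi> = 0" for k \<xi>
    using assms(3) that unfolding g_def mixed_ft_fcoef [OF f, symmetric] by (auto simp: symb_def m_def algebra_simps)
  obtain B2 where B2: "B2 \<ge> 0" "\<And>k x. (1 + \<bar>x\<bar>) ^ 2 * norm (g k 0 x) \<le> B2"
    using rapid_bound [OF g, of 0 2 0] by auto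
  have ig: "integrable lborel (g k 0)" for k
  proof -
    have "set_integrable lborel UNIV (g k 0)"
      by (rule set_integral_decay(1) [OF cg _ B2(1)]) (use B2(2) in \<open>auto simp: field_simps\<close>)
    then show ?thesis by (simp add: set_integrable_def)
  qed
  show ?thesis
  proof (cases "c2 = 0")
    case True
    obtain \<delta> where \<delta>: "\<delta> > 0" "\<And>k. m k = 0 \<or> \<delta> \<le> norm (m k)"
      using affine_int_gap [of "\<i> * c1" c3] unfolding m_def by metis
    \<comment> \<open>Since \<open>inverse 0 = 0\<close>, modes with \<open>m k = 0\<close> receive
      the zero solution, and the bound \<open>1 / \<delta>\<close> holds for them too.\<close>
    have "rapid (\<lambda>k b x. inverse (m k) * g k b x)"
    proof (rule rapid_mult [OF g, where A = "1 / \<delta>"])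
      fix k
      have "norm (inverse (m k)) \<le> 1 / \<delta>" using \<delta>(1) \<delta>(2) [of k] le_imp_inverse_le [of \<delta> "norm (m k)"]
        by (auto simp: norm_inverse divide_inverse)
      also have "\<dots> \<le> 1 / \<delta> * (1 + \<bar>of_int k\<bar>)" using \<delta>(1) by (simp add: field_simps)
      finally show "norm (inverse (m k)) \<le> 1 / \<delta> * (1 + \<bar>of_int k\<bar>)" .
    qed
    then show ?thesis
    proof (rule Lop_fser_eq [OF f])
      fix k x
      have "m k * (inverse (m k) * g k 0 x) = g k 0 x"
      proof (cases "m k = 0")
        case m0: True
        \<comment> \<open>With \<open>c2 = 0\<close> and \<open>m k = 0\<close> the symbol vanishes
          at every frequency, so the entire transform of \<open>g k 0\<close> is zero.\<close>
        have "(LINT x|lborel. g k 0 x * exp (\<i> * of_real (t * x))) = 0" for t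
          using zero [of k "- t"] m0 \<open>c2 = 0\<close> by simp
        then have "g k 0 x = 0" by (rule Fourier_injective [OF cg ig])
        then show ?thesis by simp
      qed simp
      then show "(\<i> * c1 * of_int k + c3) * (inverse (m k) * g k 0 x) + c2 * (inverse (m k) * g k (Suc 0) x) = fcoef f k 0 x"
        using True by (simp add: m_def g_def)
    qed
  next
    case False
    define l where "l k = m k / c2" for k
    have Re_l: "Re (l k) = Re (\<i> * c1 / c2) * of_int k + Re (c3 / c2)" for k
    proof -
      have "l k = \<i> * c1 / c2 * of_int k + c3 / c2" by (simp add: l_def m_def add_divide_distrib)
      moreover have "Re (z * of_int k + y) = Re z * of_int k + Re y" for z y by simp
      ultimately show ?thesis by (simp only:)
    qed
    \<comment> \<open>Only the real part of \<open>l k\<close> governs growth. It is affine in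
      \<open>k\<close> with real coefficients, so the gap lemma applies after embedding them into
      the complex numbers.\<close>
    obtain \<delta> where \<delta>: "\<delta> > 0" "\<And>k. Re (l k) = 0 \<or> \<delta> \<le> \<bar>Re (l k)\<bar>"
    proof -
      obtain \<delta> where d: "\<delta> > 0" "\<And>k::int. complex_of_real (Re (\<i> * c1 / c2)) * of_int k + of_real (Re (c3 / c2)) = 0
          \<or> \<delta> \<le> norm (complex_of_real (Re (\<i> * c1 / c2)) * of_int k + of_real (Re (c3 / c2)))"
        using affine_int_gap by blast
      have "complex_of_real (Re (\<i> * c1 / c2)) * of_int k + of_real (Re (c3 / c2)) = of_real (Re (l k))" for k
        unfolding Re_l by simp
      with d show thesis by (intro that [of \<delta>]) (simp_all only: norm_of_real of_real_eq_0_iff)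
    qed
    let ?K = "\<lambda>N :: nat. (1 + N / \<delta>) ^ N * decay_mass"
    have "\<exists>w. (\<forall>x. (w has_vector_derivative g k 0 x / c2 - l k * w x) (at x)) \<and>
       (\<forall>N B x. (\<forall>y. (1 + \<bar>y\<bar>) ^ (N + 2) * norm (g k 0 y / c2) \<le> B) \<longrightarrow>
        (1 + \<bar>x\<bar>) ^ N * norm (w x) \<le> ?K N * B)" for k
    proof (rule ode_solution [OF \<delta>(1)])
      show "continuous_on UNIV (\<lambda>x. g k 0 x / c2)" using False by (intro continuous_intros cg) auto
      show "(1 + \<bar>y\<bar>) ^ 2 * norm (g k 0 y / c2) \<le> B2 / norm c2" for y
        using divide_right_mono [OF B2(2) [of y k], of "norm c2"] by (simp add: norm_divide)
      show "\<delta> \<le> \<bar>Re (l k)\<bar> \<or> Re (l k) = 0 \<and> (LINT y|lborel. exp (l k * of_real y) * (g k 0 y / c2)) = 0"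
      proof (cases "Re (l k) = 0")
        case True
        then have lk: "l k = \<i> * of_real (Im (l k))" by (simp add: complex_eq_iff)
        have "m k + \<i> * c2 * of_real (- Im (l k)) = 0"
          using lk False by (simp add: l_def field_simps)
        from zero [OF this] have "(LINT y|lborel. g k 0 y * exp (l k * of_real y)) = 0"
          by (subst lk) (simp add: mult.assoc)
        then have "(LINT y|lborel. exp (l k * of_real y) * (g k 0 y / c2)) = 0"
          by (simp add: mult.commute)
        with True show ?thesis by simp
      qed (use \<delta>(2) [of k] in auto)
    qed
    then obtain w where w: "\<And>k x. (w k has_vector_derivative g k 0 x / c2 - l k * w k x) (at x)"
      and wb: "\<And>k N B x. (\<And>y. (1 + \<bar>y\<bar>) ^ (N + 2) * norm (g k 0 y / c2) \<le> B) \<Longrightarrow>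
        (1 + \<bar>x\<bar>) ^ N * norm (w k x) \<le> ?K N * B"
      by metis
    have bd: "\<exists>C. \<forall>k x. (1 + \<bar>of_int k\<bar>) ^ a * (1 + \<bar>x\<bar>) ^ n * norm (w k x) \<le> C" for a n
    proof -
      obtain C where C: "\<And>k x. (1 + \<bar>of_int k\<bar>) ^ a * (1 + \<bar>x\<bar>) ^ (n + 2) * norm (g k 0 x) \<le> C"
        using rapid_bound [OF g] by metis
      have "(1 + \<bar>of_int k\<bar>) ^ a * (1 + \<bar>x\<bar>) ^ n * norm (w k x) \<le> ?K n * (C / norm c2)" for k x
      proof -
        define W where "W = (1 + \<bar>real_of_int k\<bar>) ^ a"
        have W: "W > 0" by (simp add: W_def)
        \<comment> \<open>For fixed \<open>k\<close> the weight \<open>W\<close> is a constant, so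
          decay in \<open>k\<close> can be put into the bound \<open>B\<close>. As \<open>wb\<close>
          is linear in \<open>B\<close> with a factor independent of \<open>k\<close>, this decay
          passes to \<open>w k\<close>.\<close>
        have "(1 + \<bar>y\<bar>) ^ (n + 2) * norm (g k 0 y / c2) \<le> C / norm c2 / W" for y
          using divide_right_mono [OF divide_right_mono [OF C [of k y]], of "norm c2" W] W
          by (simp add: norm_divide W_def [symmetric] mult.assoc)
        from wb [OF this] have "W * ((1 + \<bar>x\<bar>) ^ n * norm (w k x)) \<le> W * (?K n * (C / norm c2 / W))"
          using W by (intro mult_left_mono) auto
        then show ?thesis using W by (simp add: W_def mult.assoc)
      qed
      then show ?thesis by blast
    qed
    have "rapid (\<lambda>k. ode_jet c2 (m k) (g k) (w k))"
    proof (rule rapid_ode_jet [OF g False _ _ bd])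
      show "(w k has_vector_derivative (g k 0 x - m k * w k x) / c2) (at x)" for k x
        using w [of k x] by (simp add: l_def diff_divide_distrib)
      show "norm (m k) \<le> (norm c1 + norm c3) * (1 + \<bar>of_int k\<bar>)" for k
      proof -
        have "norm (m k) \<le> norm c1 * \<bar>of_int k\<bar> + norm c3"
          unfolding m_def by (rule order_trans [OF norm_triangle_ineq]) (simp add: norm_mult)
        also have "\<dots> \<le> norm c1 * \<bar>of_int k\<bar> + norm c3 + (norm c1 + norm c3 * \<bar>of_int k\<bar>)" by simp
        also have "\<dots> = (norm c1 + norm c3) * (1 + \<bar>of_int k\<bar>)" by (simp add: algebra_simps)
        finally show ?thesis .
      qed
    qed
    then show ?thesis
    proof (rule Lop_fser_eq [OF f])
      show "(\<i> * c1 * of_int k + c3) * ode_jet c2 (m k) (g k) (w k) 0 x + c2 * ode_jet c2 (m k) (g k) (w k) (Suc 0) x = fcoef f k 0 x" for k x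
        using False by (simp add: m_def [symmetric] g_def)
    qed
  qed
qed

end
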